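(* Let $(X_i)_{i\geq 1}$ be a stationary ergodic sequence taking values in $\mathbb{R}^d$ and let $h\colon\mathbb{R}^d\times\mathbb{R}^d\to\mathbb{R}$ be a measurable function such that the family $\{h(X_1,X_j): j\geq 1\}$ is uniformly integrable. Let $F$ be the distribution of $X_1$. Assume that one of the following two assumptions is satisfied: (A.1) the function $h$ is $F\times F$-almost everywhere continuous and symmetric (that is, $h(x,y)=h(y,x)$ for all $x,y$); (A.2) $\int_{\mathbb{R}^d}\int_{\mathbb{R}^d}|h(x,y)|\,dF(x)\,dF(y)$ is finite, the random variable $X_1$ has a bounded density with respect to the Lebesgue measure on $\mathbb{R}^d$, and for each $k\geq 1$ the vector $(X_1,X_{1+k})$ has a density $f_k$ with respect to the Lebesgue measure on $\mathbb{R}^d\times\mathbb{R}^d$, with $\sup_{k\geq 1}\sup_{s,t\in\mathbb{R}^d}f_k(s,t)<\infty$. Then $$\lim_{n\to\infty}\mathbb{E}\left[\left|\frac{1}{\binom{n}{2}}\sum_{1\leq i<j\leq n}h(X_i,X_j)-\int_{\mathbb{R}^d}\int_{\mathbb{R}^d}h(x,y)\,dF(x)\,dF(y)\right|\right]=0.$$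
   Context: "$F\times F$-almost everywhere continuous" means that the set of points $(x,y)\in\mathbb{R}^d\times\mathbb{R}^d$ at which $h$ is not continuous has measure zero for the product measure $F\times F$. "Stationary ergodic" means that the sequence is strictly stationary and that the shift is ergodic for its law. *)

theory Defs
  imports "HOL-Probability.Probability"
begin

(* Sequences are indexed by i \<ge> 1: X 0 is never constrained or used. *)

abbreviation path_space :: "(nat \<Rightarrow> 'a::topological_space) measure" where
  "path_space \<equiv> Pi\<^sub>M {1::nat..} (\<lambda>_. borel)"

definition path_law :: "'w measure \<Rightarrow> (nat \<Rightarrow> 'w \<Rightarrow> 'a::topological_space) \<Rightarrow> (nat \<Rightarrow> 'a) measure" where
  "path_law M X = distr M path_space (\<lambda>\<omega>. \<lambda>i\<in>{1..}. X i \<omega>)"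

definition path_shift :: "(nat \<Rightarrow> 'a) \<Rightarrow> (nat \<Rightarrow> 'a)" where
  "path_shift x = (\<lambda>i\<in>{1..}. x (Suc i))"

definition strictly_stationary :: "'w measure \<Rightarrow> (nat \<Rightarrow> 'w \<Rightarrow> 'a::topological_space) \<Rightarrow> bool" where
  "strictly_stationary M X \<longleftrightarrow> (\<forall>k. path_law M (\<lambda>i. X (i + k)) = path_law M X)"

definition shift_ergodic :: "(nat \<Rightarrow> 'a::topological_space) measure \<Rightarrow> bool" where
  "shift_ergodic P \<longleftrightarrow>
    (\<forall>A\<in>sets P. path_shift -` A \<inter> space P = A \<longrightarrow> measure P A = 0 \<or> measure P A = 1)"

definition stationary_ergodic :: "'w measure \<Rightarrow> (nat \<Rightarrow> 'w \<Rightarrow> 'a::topological_space) \<Rightarrow> bool" where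
  "stationary_ergodic M X \<longleftrightarrow> strictly_stationary M X \<and> shift_ergodic (path_law M X)"

definition uniformly_integrable :: "'w measure \<Rightarrow> 'i set \<Rightarrow> ('i \<Rightarrow> 'w \<Rightarrow> real) \<Rightarrow> bool" where
  "uniformly_integrable M J Y \<longleftrightarrow>
    (\<forall>j\<in>J. Y j \<in> borel_measurable M) \<and>
    ((\<lambda>R::real. SUP j\<in>J. \<integral>\<^sup>+\<omega>. ennreal \<bar>Y j \<omega>\<bar> * indicator {\<omega>. R < \<bar>Y j \<omega>\<bar>} \<omega> \<partial>M) \<longlongrightarrow> 0) at_top"

end

theory Submission
  imports Defs
begin

text \<open>Call a kernel consistent if its U-statistic converges in \<open>L\<^sup>1\<close> to its integral against
  \<open>F \<times> F\<close>. Birkhoff's ergodic theorem and a Cesaro argument show that every product \<open>a x * b y\<close> of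
  bounded functions is consistent, hence so is every step function over a finite grid of measurable
  rectangles. A bounded kernel that is almost everywhere continuous lies between two such step
  functions (supremum and infimum over the cells of ever finer partitions) whose integrals nearly
  agree. Under the density assumption, the laws of all pairs \<open>(X 1, X (1 + k))\<close> are uniformly
  small on sets decreasing to the empty set, so the consistent indicators form a Dynkin system and every
  bounded measurable kernel is consistent. Uniform integrability removes the boundedness.\<close>

section \<open>The pointwise ergodic theorem\<close>

text \<open>The law of \<open>(X i, X j)\<close> is in general not F x F and may even be singular to
  it, so closeness of two kernels in L^1(F x F) by itself says nothing about their U-statistics. The
  obstacle is to carry smallness from one kind of measure to the other. By stationarity a pair law
  depends only on the gap, so an error that is small along \<open>(X 1, X (1 + k))\<close> uniformly
  in \<open>k\<close> is small in every U-statistic; bounded pair densities give this uniformity.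
  For almost everywhere continuous kernels no pair law is estimated directly: the width of the
  enclosure is itself a step function, hence consistent, and its U-statistic inherits the smallness
  of its F x F integral. In the reverse direction, consistency of bounded kernels turns pair bounds
  into F x F bounds, which is how integrability of \<open>h\<close> is obtained. Product kernels
  require no mixing, because their double sum can be rewritten through one-variable averages, to
  which Birkhoff's theorem applies.\<close>

primrec garsia_max :: "('a \<Rightarrow> 'a) \<Rightarrow> ('a \<Rightarrow> real) \<Rightarrow> nat \<Rightarrow> 'a \<Rightarrow> real" where
  "garsia_max T f 0 x = 0"
| "garsia_max T f (Suc n) x = max 0 (f x + garsia_max T f n (T x))"

lemma garsia_max_nonneg: "0 \<le> garsia_max T f n x"
  by (cases n) auto

lemma garsia_max_mono_Suc: "garsia_max T f n x \<le> garsia_max T f (Suc n) x"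
proof (induction n arbitrary: x)
  case (Suc n)
  show ?case
    using Suc[of "T x"] by simp
qed simp

lemma sum_orbit_Suc:
  fixes f :: "'a \<Rightarrow> real"
  shows "(\<Sum>i<Suc n. f ((T ^^ i) x)) = f x + (\<Sum>i<n. f ((T ^^ i) (T x)))"
  by (simp add: sum.lessThan_Suc_shift funpow_swap1 del: sum.lessThan_Suc)

text \<open>Unrolling the recursion shows \<open>garsia_max T f n x\<close> to be the largest of the
  orbit sums of length at most \<open>n\<close>, the empty sum 0 included. The recursive form makes
  the comparison with the value at \<open>T x\<close> immediate.\<close>

lemma sum_le_garsia_max: "(\<Sum>i<n. f ((T ^^ i) x)) \<le> garsia_max T f n x"
proof (induction n arbitrary: x)
  case (Suc n)
  show ?case
    using Suc[of "T x"] unfolding sum_orbit_Suc by simp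
qed simp

locale ergodic_system = prob_space P for P :: "'b measure" +
  fixes T :: "'b \<Rightarrow> 'b"
  assumes T_measurable [measurable]: "T \<in> P \<rightarrow>\<^sub>M P"
    and T_preserves: "distr P P T = P"
    and T_ergodic: "\<And>A. A \<in> sets P \<Longrightarrow> T -` A \<inter> space P = A \<Longrightarrow> prob A = 0 \<or> prob A = 1"
begin

lemma funpow_T_measurable [measurable]: "T ^^ i \<in> P \<rightarrow>\<^sub>M P"
  by (induction i) (simp_all add: measurable_comp[where N = P] id_def)

lemma integrable_T: "integrable P g \<Longrightarrow> integrable P (\<lambda>x. g (T x))" for g :: "'b \<Rightarrow> real"
  by (metis T_measurable T_preserves integrable_distr)

lemma integral_T: "integrable P g \<Longrightarrow> (\<integral>x. g (T x) \<partial>P) = integral\<^sup>L P g" for g :: "'b \<Rightarrow> real"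
  by (metis T_measurable T_preserves borel_measurable_integrable integral_distr)

lemma integrable_garsia_max:
  fixes f :: "'b \<Rightarrow> real"
  assumes "integrable P f" shows "integrable P (garsia_max T f n)"
proof (induction n)
  case (Suc n)
  show ?case
    using integrable_T[OF Suc] assms by simp
qed simp

text \<open>Garsia's argument. The difference of \<open>garsia_max T f n\<close> and its composition
  with \<open>T\<close> integrates to 0 by invariance and is dominated by \<open>f\<close>
  restricted to \<open>G n\<close>, so \<open>f\<close> has nonnegative integral over each
  \<open>G n\<close>. The hypothesis on positive sums makes the \<open>G n\<close> exhaust almost
  the whole space.\<close>

theorem maximal_ergodic:
  fixes f :: "'b \<Rightarrow> real"
  assumes f: "integrable P f" and pos: "AE x in P. \<exists>n. 0 < (\<Sum>i<n. f ((T ^^ i) x))"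
  shows "0 \<le> integral\<^sup>L P f"
proof -
  define G where "G n = {x \<in> space P. 0 < garsia_max T f n x}" for n
  note int = integrable_garsia_max[OF f]
  have G_meas [measurable]: "G n \<in> sets P" for n
    using int[of n] unfolding G_def by measurable
  have f_meas [measurable]: "f \<in> borel_measurable P"
    using f by simp
  have nonneg: "0 \<le> (\<integral>x. f x * indicator (G n) x \<partial>P)" for n
  proof -
    \<comment> \<open>Where the maximum is positive, a nonempty sum attains it, so it equals
      \<open>f x\<close> plus the maximum of one step less at \<open>T x\<close>. Elsewhere the left
      side is 0 minus a nonnegative number.\<close>
    have "garsia_max T f n x - garsia_max T f n (T x) \<le> f x * indicator (G n) x"
      if "x \<in> space P" for x
    proof (cases "garsia_max T f n x > 0")
      case True
      then obtain m where m: "n = Suc m" by (cases n) auto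
      have "garsia_max T f n x = f x + garsia_max T f m (T x)"
        using True unfolding m by (simp add: max_def split: if_splits)
      then show ?thesis
        using garsia_max_mono_Suc[of T f m "T x"] True that by (simp add: G_def m)
    next
      case False
      then show ?thesis
        using garsia_max_nonneg[of T f n x] garsia_max_nonneg[of T f n "T x"] by (simp add: G_def)
    qed
    then have "(\<integral>x. garsia_max T f n x - garsia_max T f n (T x) \<partial>P) \<le> (\<integral>x. f x * indicator (G n) x \<partial>P)"
      using int[of n] integrable_T[OF int[of n]] f
      by (intro integral_mono) (auto intro: integrable_real_mult_indicator)
    then show ?thesis
      using int[of n] integrable_T[OF int[of n]] integral_T[OF int[of n]] by simp
  qed
  have "(\<lambda>n. \<integral>x. f x * indicator (G n) x \<partial>P) \<longlonglongrightarrow> integral\<^sup>L P f"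
  proof (rule integral_dominated_convergence[where w = "\<lambda>x. \<bar>f x\<bar>"])
    show "AE x in P. (\<lambda>n. f x * indicator (G n) x) \<longlonglongrightarrow> f x"
      using pos AE_space
    proof eventually_elim
      case (elim x)
      then obtain N where N: "0 < (\<Sum>i<N. f ((T ^^ i) x))" by blast
      have "x \<in> G n" if "n \<ge> N" for n
      proof -
        have "garsia_max T f N x \<le> garsia_max T f n x"
          using that by (rule lift_Suc_mono_le[of "\<lambda>n. garsia_max T f n x", OF garsia_max_mono_Suc])
        then show ?thesis
          using N sum_le_garsia_max[of f T x N] elim by (simp add: G_def)
      qed
      then have "\<forall>\<^sub>F n in sequentially. f x * indicator (G n) x = f x"
        by (auto simp: eventually_sequentially intro!: exI[of _ N])
      then show ?case
        by (rule tendsto_eventually)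
    qed
  qed (use f in \<open>auto simp: indicator_def\<close>)
  then show ?thesis
    by (rule LIMSEQ_le_const) (use nonneg in auto)
qed

text \<open>Unboundedness of the Birkhoff sums is a strictly invariant event, because replacing
  \<open>x\<close> by \<open>T x\<close> changes the sums only by \<open>f x\<close> and an index shift.\<close>

lemma AE_sums_bounded_above:
  fixes f :: "'b \<Rightarrow> real"
  assumes f: "integrable P f" and neg: "integral\<^sup>L P f < 0"
  shows "AE x in P. \<exists>C. \<forall>n. (\<Sum>i<n. f ((T ^^ i) x)) \<le> C"
proof -
  define S where "S n x = (\<Sum>i<n. f ((T ^^ i) x))" for n x
  have f_meas [measurable]: "f \<in> borel_measurable P"
    using f by simp
  have [measurable]: "S n \<in> borel_measurable P" for n
    unfolding S_def by measurable
  define A where "A = {x \<in> space P. \<forall>k::nat. \<exists>n. real k < S n x}"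
  have A_sets [measurable]: "A \<in> sets P"
    unfolding A_def by measurable
  have S_Suc: "S (Suc n) x = f x + S n (T x)" for n x
    unfolding S_def by (rule sum_orbit_Suc)
  have "T x \<in> A \<longleftrightarrow> x \<in> A" if x: "x \<in> space P" for x
  proof
    assume TA: "T x \<in> A"
    have "\<exists>n. real k < S n x" for k
    proof -
      obtain n where "real (nat \<lceil>real k - f x\<rceil>) < S n (T x)"
        using TA by (auto simp: A_def)
      then have "real k < S (Suc n) x"
        unfolding S_Suc by linarith
      then show ?thesis ..
    qed
    with x show "x \<in> A" by (simp add: A_def)
  next
    assume xA: "x \<in> A"
    have "\<exists>n. real k < S n (T x)" for k
    proof -
      obtain n where n: "real (nat \<lceil>real k + \<bar>f x\<bar>\<rceil>) < S n x"
        using xA unfolding A_def by blast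
      \<comment> \<open>The empty sum is 0 and cannot exceed a natural number, so one term can be
        split off.\<close>
      then have "n \<noteq> 0"
        by (auto simp: S_def intro: Nat.gr0I)
      then obtain m where m: "n = Suc m" by (cases n) auto
      have "real k < S m (T x)"
        using n unfolding m S_Suc by linarith
      then show ?thesis ..
    qed
    moreover have "T x \<in> space P"
      using x measurable_space[OF T_measurable] by blast
    ultimately show "T x \<in> A" by (simp add: A_def)
  qed
  moreover have "A \<subseteq> space P"
    by (auto simp: A_def)
  ultimately have "T -` A \<inter> space P = A"
    by auto
  then have "prob A = 0 \<or> prob A = 1"
    using T_ergodic A_sets by blast
  \<comment> \<open>Otherwise almost every orbit would have a positive sum, and the maximal ergodic
    theorem would contradict \<open>neg\<close>.\<close>
  moreover have "prob A \<noteq> 1"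
  proof
    assume "prob A = 1"
    then have "AE x in P. x \<in> A"
      using A_sets by (simp add: AE_in_set_eq_1)
    then have "AE x in P. \<exists>n. 0 < S n x"
      by eventually_elim (force simp: A_def dest: spec[of _ 0])
    then have "0 \<le> integral\<^sup>L P f"
      using maximal_ergodic[OF f] by (simp add: S_def)
    with neg show False by simp
  qed
  ultimately have "AE x in P. x \<notin> A"
    using A_sets by (simp add: prob_eq_0)
  then have "AE x in P. \<exists>C. \<forall>n. S n x \<le> C"
    using AE_space by eventually_elim (auto simp: A_def not_less)
  then show ?thesis
    by (simp add: S_def)
qed

text \<open>For \<open>d\<close> strictly between the integral and \<open>c\<close>, the function
  \<open>f - d\<close> has negative integral, so its orbit sums stay below some \<open>C\<close>
  depending on the point. The gap \<open>c - d\<close> eventually beats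
  \<open>C / n\<close>.\<close>

lemma AE_averages_eventually_less:
  fixes f :: "'b \<Rightarrow> real"
  assumes f: "integrable P f" and less: "integral\<^sup>L P f < c"
  shows "AE x in P. \<forall>\<^sub>F n in sequentially. (\<Sum>i<n. f ((T ^^ i) x)) / real n < c"
proof -
  obtain d where d: "integral\<^sup>L P f < d" "d < c"
    using less dense by blast
  have "AE x in P. \<exists>C. \<forall>n. (\<Sum>i<n. f ((T ^^ i) x) - d) \<le> C"
    using f d by (intro AE_sums_bounded_above) (auto simp: prob_space)
  then show ?thesis
  proof eventually_elim
    case (elim x)
    then obtain C where C: "\<And>n. (\<Sum>i<n. f ((T ^^ i) x)) - real n * d \<le> C"
      by (auto simp: sum_subtractf)
    obtain N :: nat where N: "C / (c - d) < real N"
      using reals_Archimedean2 by blast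
    have "(\<Sum>i<n. f ((T ^^ i) x)) / real n < c" if n: "n \<ge> Suc N" for n
    proof -
      have "C < real N * (c - d)"
        using N d by (simp add: divide_less_eq)
      also have "\<dots> \<le> real n * (c - d)"
        using n d by (intro mult_right_mono) auto
      finally have "(\<Sum>i<n. f ((T ^^ i) x)) < real n * c"
        using C[of n] by (simp add: algebra_simps)
      then show ?thesis
        using n by (simp add: divide_less_eq mult.commute)
    qed
    then show ?case
      by (auto simp: eventually_sequentially)
  qed
qed

text \<open>The upper estimate for \<open>f\<close> and for \<open>- f\<close> brackets the
  averages. The thresholds \<open>1 / Suc k\<close> come arbitrarily close to 0 and, being countably
  many, cost only one null set.\<close>

theorem birkhoff:
  fixes f :: "'b \<Rightarrow> real"
  assumes f: "integrable P f"
  shows "AE x in P. (\<lambda>n. (\<Sum>i<n. f ((T ^^ i) x)) / real n) \<longlonglongrightarrow> integral\<^sup>L P f"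
proof -
  define e where "e k = 1 / real (Suc k)" for k
  have "AE x in P. \<forall>k. \<forall>\<^sub>F n in sequentially. (\<Sum>i<n. f ((T ^^ i) x)) / real n < integral\<^sup>L P f + e k"
    using f by (auto simp: AE_all_countable e_def intro!: AE_averages_eventually_less)
  moreover have "AE x in P. \<forall>k. \<forall>\<^sub>F n in sequentially.
      (\<Sum>i<n. - f ((T ^^ i) x)) / real n < - integral\<^sup>L P f + e k"
    using f by (auto simp: AE_all_countable e_def intro!: AE_averages_eventually_less)
  ultimately show ?thesis
  proof eventually_elim
    case (elim x)
    show ?case
    proof (rule tendstoI)
      fix r :: real assume "0 < r"
      then obtain k where "e k < r"
        unfolding e_def using nat_approx_posE by blast
      from elim(1)[rule_format, of k] elim(2)[rule_format, of k]
      show "\<forall>\<^sub>F n in sequentially. dist ((\<Sum>i<n. f ((T ^^ i) x)) / real n) (integral\<^sup>L P f) < r"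
        by eventually_elim (use \<open>e k < r\<close> in \<open>auto simp: dist_real_def sum_negf abs_less_iff\<close>)
    qed
  qed
qed

end

section \<open>U-statistics of product kernels along a sequence\<close>

definition pairs :: "nat \<Rightarrow> (nat \<times> nat) set" where
  "pairs n = {(i, j). 1 \<le> i \<and> i < j \<and> j \<le> n}"

text \<open>The swap makes \<open>j\<close> the outer index, so that the inner sums over
  \<open>i < j\<close> become partial sums.\<close>

lemma pairs_eq_Sigma: "pairs n = prod.swap ` (SIGMA j:{1..n}. {1..<j})"
  by (auto simp: pairs_def image_iff)

lemma finite_pairs [simp]: "finite (pairs n)"
  by (simp add: pairs_eq_Sigma)

lemma sum_pairs: "sum f (pairs n) = (\<Sum>j=1..n. \<Sum>i=1..<j. f (i, j))"
  unfolding pairs_eq_Sigma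
  by (subst sum.reindex) (auto simp: inj_on_def sum.Sigma intro!: sum.cong)

lemma card_pairs: "card (pairs n) = n choose 2"
proof -
  have "card (pairs n) = (\<Sum>j=1..n. j - 1)"
    using sum_pairs[of "\<lambda>_. 1::nat" n] by simp
  also have "\<dots> = n choose 2"
    by (induction n) (auto simp: numeral_2_eq_2)
  finally show ?thesis .
qed

definition ustat :: "nat \<Rightarrow> ('a \<times> 'a \<Rightarrow> real) \<Rightarrow> (nat \<Rightarrow> 'a) \<Rightarrow> real" where
  "ustat n h x = 1 / real (n choose 2) * (\<Sum>(i, j)\<in>pairs n. h (x i, x j))"

lemma ustat_sum: "ustat n (\<lambda>z. \<Sum>k\<in>K. c k * g k z) x = (\<Sum>k\<in>K. c k * ustat n (g k) x)"
  unfolding ustat_def split_def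
  by (subst sum.swap) (simp add: sum_distrib_left mult_ac)

lemma ustat_diff: "ustat n (\<lambda>z. g z - h z) x = ustat n g x - ustat n h x"
  by (simp add: ustat_def split_def sum_subtractf right_diff_distrib)

lemma ustat_mono: "(\<And>z. g z \<le> h z) \<Longrightarrow> ustat n g x \<le> ustat n h x"
  by (auto simp: ustat_def split_def intro!: divide_right_mono sum_mono)

lemma abs_ustat_le: "\<bar>ustat n h x\<bar> \<le> ustat n (\<lambda>z. \<bar>h z\<bar>) x"
  by (auto simp: ustat_def abs_mult split_def intro!: divide_right_mono sum_abs)

lemma abs_ustat_le_bound:
  assumes "\<And>z. \<bar>h z\<bar> \<le> R" shows "\<bar>ustat n h x\<bar> \<le> R"
proof -
  have "0 \<le> R" using assms[of undefined] by linarith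
  have "\<bar>ustat n h x\<bar> \<le> ustat n (\<lambda>_. R) x"
    by (rule order_trans[OF abs_ustat_le ustat_mono[OF assms]])
  \<comment> \<open>For n < 2 the normalising factor is 1 / 0 = 0 and the sum vanishes, whence an
    inequality that uses the sign of \<open>R\<close>; for larger n the weights add up to 1.\<close>
  also have "\<dots> \<le> R"
    using \<open>0 \<le> R\<close> by (cases "n choose 2 = 0") (simp_all add: ustat_def split_def card_pairs)
  finally show ?thesis .
qed

lemma cesaro_tendsto_zero:
  fixes e :: "nat \<Rightarrow> real"
  assumes "e \<longlonglongrightarrow> 0"
  shows "(\<lambda>n. (\<Sum>k=1..n. e k) / real n) \<longlonglongrightarrow> 0"
proof (rule LIMSEQ_I)
  fix r :: real assume r: "0 < r"
  obtain N where N: "\<And>n. n \<ge> N \<Longrightarrow> \<bar>e n\<bar> < r / 2"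
    using LIMSEQ_D[OF assms, of "r / 2"] r by auto
  define C where "C = (\<Sum>k\<le>N. \<bar>e k\<bar>)"
  have C: "(\<Sum>k=1..n. \<bar>e k\<bar>) \<le> C + real n * (r / 2)" for n
  proof -
    have "(\<Sum>k=1..n. \<bar>e k\<bar>) \<le> (\<Sum>k=1..n. (if k \<le> N then \<bar>e k\<bar> else 0) + r / 2)"
      using N r by (intro sum_mono) (auto simp: not_le intro!: less_imp_le)
    also have "\<dots> = (\<Sum>k\<in>{1..n} \<inter> {..N}. \<bar>e k\<bar>) + real n * (r / 2)"
      unfolding sum.distrib sum.inter_restrict[OF finite_atLeastAtMost] by simp
    also have "(\<Sum>k\<in>{1..n} \<inter> {..N}. \<bar>e k\<bar>) \<le> C"
      unfolding C_def by (intro sum_mono2) auto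
    finally show ?thesis by simp
  qed
  obtain M :: nat where M: "2 * C / r < real M"
    using reals_Archimedean2 by blast
  show "\<exists>no. \<forall>n\<ge>no. norm ((\<Sum>k=1..n. e k) / real n - 0) < r"
  proof (intro exI allI impI)
    fix n assume n: "n \<ge> Suc M"
    have "2 * C < real M * r"
      using M r by (simp add: divide_less_eq)
    also have "\<dots> \<le> real n * r"
      using n r by (intro mult_right_mono) auto
    finally have "(\<Sum>k=1..n. \<bar>e k\<bar>) < real n * r"
      using C[of n] by simp
    moreover have "\<bar>\<Sum>k=1..n. e k\<bar> \<le> (\<Sum>k=1..n. \<bar>e k\<bar>)"
      by (rule sum_abs)
    ultimately have "\<bar>\<Sum>k=1..n. e k\<bar> < real n * r"
      by linarith
    then show "norm ((\<Sum>k=1..n. e k) / real n - 0) < r"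
      using n by (simp add: divide_less_eq mult.commute)
  qed
qed

text \<open>Meant for \<open>c\<close> the deviation of a partial sum from its linear limit, which
  is of order o(m). Each term is at most \<open>B * (n * e j)\<close> with \<open>e\<close> tending
  to 0, so division by n^2 leaves a Cesaro average. The offset \<open>p\<close> serves both partial
  sums that stop before \<open>j\<close> and those that include \<open>j\<close>.\<close>

lemma weighted_cesaro_tendsto_zero:
  fixes c w :: "nat \<Rightarrow> real"
  assumes c: "(\<lambda>m. c m / real m) \<longlonglongrightarrow> 0" and c0: "c 0 = 0" and w: "\<And>j. \<bar>w j\<bar> \<le> B"
  shows "(\<lambda>n. (\<Sum>j=1..n. w j * c (j - p)) / (real n)\<^sup>2) \<longlonglongrightarrow> 0"
proof (rule Lim_null_comparison)
  define e where "e j = \<bar>c (j - p) / real (j - p)\<bar>" for j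
  have "(\<lambda>j. c (j - p) / real (j - p)) \<longlonglongrightarrow> 0"
    by (rule filterlim_compose[OF c filterlim_minus_const_nat_at_top])
  then have "e \<longlonglongrightarrow> 0"
    unfolding e_def by (rule tendsto_rabs_zero)
  then show "(\<lambda>n. B * ((\<Sum>j=1..n. e j) / real n)) \<longlonglongrightarrow> 0"
    using tendsto_mult_right_zero[OF cesaro_tendsto_zero] by blast
  have "norm ((\<Sum>j=1..n. w j * c (j - p)) / (real n)\<^sup>2) \<le> B * ((\<Sum>j=1..n. e j) / real n)" for n
  proof (cases "n = 0")
    case False
    have "0 \<le> B"
      using w[of 0] by linarith
    \<comment> \<open>If \<open>j\<close> is at most \<open>p\<close>, truncated subtraction gives
      \<open>j - p = 0\<close>; then 0 / 0 = 0 makes \<open>e j\<close> vanish, and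
      \<open>c0\<close> rescues the bound.\<close>
    have le: "\<bar>c (j - p)\<bar> \<le> real n * e j" if "j \<le> n" for j
    proof (cases "j - p = 0")
      case False
      have "\<bar>c (j - p)\<bar> = real (j - p) * e j"
        using False by (simp add: e_def)
      also have "\<dots> \<le> real n * e j"
        using that by (intro mult_right_mono) (auto simp: e_def)
      finally show ?thesis .
    qed (simp add: c0 e_def)
    have "\<bar>\<Sum>j=1..n. w j * c (j - p)\<bar> \<le> (\<Sum>j=1..n. \<bar>w j * c (j - p)\<bar>)"
      by (rule sum_abs)
    also have "\<dots> \<le> (\<Sum>j=1..n. B * (real n * e j))"
      unfolding abs_mult using w le \<open>0 \<le> B\<close> by (intro sum_mono mult_mono) auto
    also have "\<dots> = B * (real n * (\<Sum>j=1..n. e j))"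
      by (simp add: sum_distrib_left)
    finally show ?thesis
      using False by (simp add: divide_simps power2_eq_square mult_ac)
  qed simp
  then show "\<forall>\<^sub>F n in sequentially. norm ((\<Sum>j=1..n. w j * c (j - p)) / (real n)\<^sup>2)
      \<le> B * ((\<Sum>j=1..n. e j) / real n)"
    by simp
qed

text \<open>Summation by parts: the linear weight is traded for partial sums of \<open>b\<close>,
  whose growth is known.\<close>

lemma sum_pred_mult: "(\<Sum>j=1..n. (real j - 1) * b j) = real n * (\<Sum>j=1..n. b j) - (\<Sum>j=1..n. \<Sum>i=1..j. b i)"
  by (induction n) (auto simp: algebra_simps)

text \<open>For fixed \<open>j\<close> the inner sum over \<open>i < j\<close> is
  \<open>(j - 1) * \<alpha>\<close> plus an error \<open>A' (j - 1)\<close> of order o(j).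
  Multiplied by the bounded \<open>b j\<close>, these errors total o(n^2). The main term, the sum of
  \<open>(j - 1) * b j\<close>, is evaluated by summation by parts.\<close>

lemma sum_mult_pairs_tendsto:
  fixes a b :: "nat \<Rightarrow> real"
  assumes a: "(\<lambda>n. (\<Sum>i=1..n. a i) / real n) \<longlonglongrightarrow> \<alpha>"
    and b: "(\<lambda>n. (\<Sum>i=1..n. b i) / real n) \<longlonglongrightarrow> \<beta>"
    and bound: "\<And>j. \<bar>b j\<bar> \<le> B"
  shows "(\<lambda>n. 1 / real (n choose 2) * (\<Sum>(i, j)\<in>pairs n. a i * b j)) \<longlonglongrightarrow> \<alpha> * \<beta>"
proof -
  define A' where "A' m = (\<Sum>i=1..m. a i) - real m * \<alpha>" for m
  define B' where "B' m = (\<Sum>i=1..m. b i) - real m * \<beta>" for m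
  have centred: "(\<lambda>n. (s n - real n * l) / real n) \<longlonglongrightarrow> 0"
    if "(\<lambda>n. s n / real n) \<longlonglongrightarrow> l" for s l
  proof (rule Lim_transform_eventually)
    show "(\<lambda>n. s n / real n - l) \<longlonglongrightarrow> 0"
      using tendsto_diff[OF that tendsto_const[of l]] by simp
    show "\<forall>\<^sub>F n in sequentially. s n / real n - l = (s n - real n * l) / real n"
      using eventually_gt_at_top[of 0] by eventually_elim (simp add: diff_divide_distrib)
  qed
  have 1: "(\<lambda>n. (\<Sum>j=1..n. b j * A' (j - 1)) / (real n)\<^sup>2) \<longlonglongrightarrow> 0"
    using centred[OF a] bound by (intro weighted_cesaro_tendsto_zero) (auto simp: A'_def)
  have 2: "(\<lambda>n. (\<Sum>j=1..n. 1 * B' (j - 0)) / (real n)\<^sup>2) \<longlonglongrightarrow> 0"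
    using centred[OF b] by (intro weighted_cesaro_tendsto_zero[where B = 1]) (auto simp: B'_def)
  have split: "(\<Sum>(i, j)\<in>pairs n. a i * b j) / (real n)\<^sup>2
      = (\<Sum>j=1..n. b j * A' (j - 1)) / (real n)\<^sup>2 + \<alpha> * ((\<Sum>i=1..n. b i) / real n)
        - \<alpha> * ((\<Sum>j=1..n. 1 * B' (j - 0)) / (real n)\<^sup>2 + \<beta> * ((1 + 1 / real n) / 2))"
    if "n \<ge> 1" for n
  proof -
    have "(\<Sum>(i, j)\<in>pairs n. a i * b j) = (\<Sum>j=1..n. b j * (\<Sum>i=1..j - 1. a i))"
      unfolding sum_pairs by (auto simp: sum_distrib_left mult.commute intro!: sum.cong)
    also have "\<dots> = (\<Sum>j=1..n. b j * A' (j - 1) + \<alpha> * ((real j - 1) * b j))"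
      by (intro sum.cong) (auto simp: A'_def algebra_simps of_nat_diff)
    also have "\<dots> = (\<Sum>j=1..n. b j * A' (j - 1)) + \<alpha> * (\<Sum>j=1..n. (real j - 1) * b j)"
      by (simp only: sum.distrib sum_distrib_left)
    also have "(\<Sum>j=1..n. (real j - 1) * b j)
        = real n * (\<Sum>j=1..n. b j) - ((\<Sum>j=1..n. 1 * B' (j - 0)) + \<beta> * (\<Sum>j=1..n. real j))"
      unfolding sum_pred_mult by (simp add: B'_def sum_subtractf sum_distrib_left mult.commute)
    also have "(\<Sum>j=1..n. real j) = real n * (real n + 1) / 2"
      by (induction n) (auto simp: field_simps)
    finally have eq: "(\<Sum>(i, j)\<in>pairs n. a i * b j) = (\<Sum>j=1..n. b j * A' (j - 1)) + \<alpha> * (real n * (\<Sum>j=1..n. b j)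
        - ((\<Sum>j=1..n. 1 * B' (j - 0)) + \<beta> * (real n * (real n + 1) / 2)))" .
    have "(P + \<alpha> * (N * Q - (Y + \<beta> * (N * (N + 1) / 2)))) / N\<^sup>2
        = P / N\<^sup>2 + \<alpha> * (Q / N) - \<alpha> * (Y / N\<^sup>2 + \<beta> * ((1 + 1 / N) / 2))" if "N \<noteq> 0" for P Q Y N :: real
      using that by (simp add: field_simps power2_eq_square)
    from this[of "real n"] show ?thesis
      unfolding eq using that by simp
  qed
  have "(\<lambda>n. 1 / real n) \<longlonglongrightarrow> 0"
    by real_asymp
  \<comment> \<open>The limit is \<alpha>\<beta> - \<alpha>\<beta>/2, half of the target, the
    subtracted half coming from the double partial sums of \<open>b\<close>. The ratio of n^2 to
    \<open>n choose 2\<close> tends to 2 and supplies the missing factor.\<close>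
  then have "(\<lambda>n. (\<Sum>j=1..n. b j * A' (j - 1)) / (real n)\<^sup>2 + \<alpha> * ((\<Sum>i=1..n. b i) / real n)
        - \<alpha> * ((\<Sum>j=1..n. 1 * B' (j - 0)) / (real n)\<^sup>2 + \<beta> * ((1 + 1 / real n) / 2)))
      \<longlonglongrightarrow> 0 + \<alpha> * \<beta> - \<alpha> * (0 + \<beta> * ((1 + 0) / 2))"
    by (intro tendsto_intros 1 2 b) auto
  then have "(\<lambda>n. (\<Sum>(i, j)\<in>pairs n. a i * b j) / (real n)\<^sup>2) \<longlonglongrightarrow> 0 + \<alpha> * \<beta> - \<alpha> * (0 + \<beta> * ((1 + 0) / 2))"
    by (rule Lim_transform_eventually)
      (use eventually_ge_at_top[of 1] in eventually_elim, simp add: split)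
  moreover have "(\<lambda>n. (real n)\<^sup>2 / (real n * (real n - 1) / 2)) \<longlonglongrightarrow> 2"
    by real_asymp
  ultimately have "(\<lambda>n. (real n)\<^sup>2 / (real n * (real n - 1) / 2) * ((\<Sum>(i, j)\<in>pairs n. a i * b j) / (real n)\<^sup>2))
      \<longlonglongrightarrow> 2 * (0 + \<alpha> * \<beta> - \<alpha> * (0 + \<beta> * ((1 + 0) / 2)))"
    by (intro tendsto_mult)
  then have "(\<lambda>n. 1 / real (n choose 2) * (\<Sum>(i, j)\<in>pairs n. a i * b j))
      \<longlonglongrightarrow> 2 * (0 + \<alpha> * \<beta> - \<alpha> * (0 + \<beta> * ((1 + 0) / 2)))"
  proof (rule Lim_transform_eventually)
    show "\<forall>\<^sub>F n in sequentially. (real n)\<^sup>2 / (real n * (real n - 1) / 2) * ((\<Sum>(i, j)\<in>pairs n. a i * b j) / (real n)\<^sup>2)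
        = 1 / real (n choose 2) * (\<Sum>(i, j)\<in>pairs n. a i * b j)"
      using eventually_ge_at_top[of 2]
    proof eventually_elim
      case (elim n)
      have "real (n choose 2) = real n * (real n - 1) / 2"
        using elim by (simp add: choose_two real_of_nat_div of_nat_diff)
      then show ?case
        unfolding \<open>real (n choose 2) = _\<close> using elim by simp
    qed
  qed
  then show ?thesis
    by (simp add: algebra_simps)
qed

section \<open>Stationary ergodic processes and consistent kernels\<close>

lemma tendsto_zero_ennrealI:
  fixes f :: "'b \<Rightarrow> ennreal"
  assumes "\<And>e::real. 0 < e \<Longrightarrow> \<forall>\<^sub>F n in A. f n \<le> ennreal e"
  shows "(f \<longlongrightarrow> 0) A"
proof (rule order_tendstoI)
  fix a :: ennreal assume "0 < a"
  then obtain c where "0 < c" "c < a"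
    using dense by blast
  then obtain e where e: "c = ennreal e" "0 < e"
    by (cases c) auto
  show "\<forall>\<^sub>F n in A. f n < a"
    using assms[OF e(2)] by eventually_elim (use \<open>c < a\<close> e in auto)
qed auto

lemma tendsto_zero_ennrealD:
  fixes f :: "'b \<Rightarrow> ennreal"
  assumes "(f \<longlongrightarrow> 0) A" "0 < e"
  shows "\<forall>\<^sub>F n in A. f n \<le> ennreal e"
proof -
  have "\<forall>\<^sub>F n in A. f n < ennreal e"
    using assms by (intro order_tendstoD(2)[OF assms(1)]) simp
  then show ?thesis
    by eventually_elim simp
qed

section \<open>Path space, the shift and stationarity\<close>

lemma funpow_path_shift:
  assumes "1 \<le> j" shows "(path_shift ^^ i) x j = x (i + j)"
  using assms by (induction i arbitrary: j) (auto simp: path_shift_def)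

lemma path_component_measurable [measurable (raw)]:
  "1 \<le> i \<Longrightarrow> (\<lambda>x. x i) \<in> borel_measurable path_space"
  by (rule measurable_component_singleton) simp

lemma path_shift_measurable [measurable]: "path_shift \<in> path_space \<rightarrow>\<^sub>M path_space"
  unfolding path_shift_def by (rule measurable_restrict) (simp add: path_component_measurable)

text \<open>Second countability makes the Borel sets of the square the product sigma-algebra, and it
  supplies the countable basis from which the cells for continuous kernels are built.\<close>

locale stationary_ergodic_process = prob_space M for M :: "'w measure" +
  fixes X :: "nat \<Rightarrow> 'w \<Rightarrow> 'a::{second_countable_topology, t2_space}"
  assumes X_measurable [measurable (raw)]: "1 \<le> i \<Longrightarrow> X i \<in> borel_measurable M"
    and X_stationary_ergodic: "stationary_ergodic M X"
begin

lemma path_measurable: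
  "(\<lambda>\<omega>. \<lambda>i\<in>{1..}. X (i + k) \<omega>) \<in> M \<rightarrow>\<^sub>M path_space"
  by (rule measurable_restrict) auto

lemma path_law_shift: "path_law M (\<lambda>i. X (i + k)) = path_law M X"
  using X_stationary_ergodic by (auto simp: stationary_ergodic_def strictly_stationary_def)

lemma sets_path_law [measurable_cong]: "sets (path_law M X) = sets path_space"
  by (simp add: path_law_def)

text \<open>Stationarity with a shift by 1 is exactly invariance of the path law under
  \<open>path_shift\<close>.\<close>

lemma ergodic_path_law: "ergodic_system (path_law M X) path_shift"
proof -
  interpret P: prob_space "path_law M X"
    unfolding path_law_def using path_measurable[of 0] by (intro prob_space_distr) simp
  show ?thesis
  proof
    show "path_shift \<in> path_law M X \<rightarrow>\<^sub>M path_law M X"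
      by (subst measurable_cong_sets[OF sets_path_law sets_path_law]) (rule path_shift_measurable)
    have "distr (path_law M X) (path_law M X) path_shift = distr (path_law M X) path_space path_shift"
      by (rule distr_cong) (auto simp: sets_path_law)
    also have "\<dots> = distr M path_space (path_shift \<circ> (\<lambda>\<omega>. \<lambda>i\<in>{1..}. X i \<omega>))"
      unfolding path_law_def using path_measurable[of 0] by (intro distr_distr path_shift_measurable) simp
    also have "path_shift \<circ> (\<lambda>\<omega>. \<lambda>i\<in>{1..}. X i \<omega>) = (\<lambda>\<omega>. \<lambda>i\<in>{1..}. X (i + 1) \<omega>)"
      by (auto simp: path_shift_def fun_eq_iff)
    also have "distr M path_space \<dots> = path_law M X"
      using path_law_shift[of 1] by (simp add: path_law_def)
    finally show "distr (path_law M X) (path_law M X) path_shift = path_law M X" .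
  qed (use X_stationary_ergodic in \<open>auto simp: stationary_ergodic_def shift_ergodic_def\<close>)
qed

text \<open>Both sides are the same integral over the path law, read through the process shifted by
  \<open>i - 1\<close> and by 0. All estimates along pairs thereby reduce to pairs that start at
  index 1.\<close>

lemma nn_integral_pair_shift:
  assumes g: "g \<in> borel_measurable borel" and ij: "1 \<le> i" "i < j"
  shows "(\<integral>\<^sup>+\<omega>. g (X i \<omega>, X j \<omega>) \<partial>M) = (\<integral>\<^sup>+\<omega>. g (X 1 \<omega>, X (1 + (j - i)) \<omega>) \<partial>M)"
proof -
  have law: "(\<integral>\<^sup>+\<omega>. g (X (1 + k) \<omega>, X (1 + (j - i) + k) \<omega>) \<partial>M)
      = (\<integral>\<^sup>+x. g (x 1, x (1 + (j - i))) \<partial>path_law M X)" for k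
  proof -
    have "(\<lambda>x :: nat \<Rightarrow> 'a. (x 1, x (1 + (j - i)))) \<in> borel_measurable path_space"
      by (intro borel_measurable_Pair path_component_measurable) auto
    then have "(\<lambda>x. g (x 1, x (1 + (j - i)))) \<in> borel_measurable path_space"
      by (rule measurable_compose) (rule g)
    then have "(\<integral>\<^sup>+x. g (x 1, x (1 + (j - i))) \<partial>path_law M (\<lambda>i. X (i + k)))
        = (\<integral>\<^sup>+\<omega>. g (X (1 + k) \<omega>, X (1 + (j - i) + k) \<omega>) \<partial>M)"
      unfolding path_law_def by (subst nn_integral_distr[OF path_measurable]) auto
    then show ?thesis
      unfolding path_law_shift by simp
  qed
  show ?thesis
    using law[of "i - 1"] law[of 0] ij by simp
qed

definition marginal :: "'a measure" where
  "marginal = distr M borel (X 1)"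

lemma sets_marginal [simp, measurable_cong]: "sets marginal = sets borel"
  by (simp add: marginal_def)

lemma space_marginal [simp]: "space marginal = UNIV"
  by (simp add: marginal_def)

lemma prob_space_marginal: "prob_space marginal"
  unfolding marginal_def by (rule prob_space_distr) simp

sublocale F: prob_space marginal
  by (rule prob_space_marginal)

sublocale FF: pair_prob_space marginal marginal ..

lemma sets_marginal_pair [simp, measurable_cong]: "sets (marginal \<Otimes>\<^sub>M marginal) = sets borel"
  by (metis borel_prod sets_marginal sets_pair_measure_cong)

text \<open>The sample space carries no transformation, so Birkhoff's theorem is applied on path
  space to a function of the first coordinate, and the almost sure statement is pulled back along
  the path map.\<close>

lemma AE_averages_tendsto:
  fixes a :: "'a \<Rightarrow> real"
  assumes [measurable]: "a \<in> borel_measurable borel" and int: "integrable marginal a"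
  shows "AE \<omega> in M. (\<lambda>n. (\<Sum>i=1..n. a (X i \<omega>)) / real n) \<longlonglongrightarrow> integral\<^sup>L marginal a"
proof -
  interpret P: ergodic_system "path_law M X" path_shift
    by (rule ergodic_path_law)
  have path: "(\<lambda>\<omega>. \<lambda>i\<in>{1..}. X i \<omega>) \<in> M \<rightarrow>\<^sub>M path_space"
    using path_measurable[of 0] by simp
  have marg: "marginal = distr (path_law M X) borel (\<lambda>x. x 1)"
    unfolding marginal_def path_law_def
    by (subst distr_distr[OF path_component_measurable path]) (auto simp: comp_def)
  have 1[measurable]: "(\<lambda>x. x 1) \<in> borel_measurable (path_law M X)"
    by measurable
  have "integrable (path_law M X) (\<lambda>x. a (x 1))"
    using int unfolding marg by (subst (asm) integrable_distr_eq) (rule 1, rule assms)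
  then have "AE x in path_law M X.
      (\<lambda>n. (\<Sum>i<n. a ((path_shift ^^ i) x 1)) / real n) \<longlonglongrightarrow> (\<integral>x. a (x 1) \<partial>path_law M X)"
    by (rule P.birkhoff)
  then have "AE \<omega> in M. (\<lambda>n. (\<Sum>i<n. a ((path_shift ^^ i) (\<lambda>i\<in>{1..}. X i \<omega>) 1)) / real n)
      \<longlonglongrightarrow> (\<integral>x. a (x 1) \<partial>path_law M X)"
    unfolding path_law_def by (rule AE_distrD[OF path])
  moreover have "(\<integral>x. a (x 1) \<partial>path_law M X) = integral\<^sup>L marginal a"
    unfolding marg by (rule integral_distr[symmetric, OF 1 assms(1)])
  \<comment> \<open>Coordinate 1 after \<open>i\<close> shifts is coordinate \<open>i + 1\<close>,
    which turns the orbit sum over \<open>i < n\<close> into the sum from 1 to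
    \<open>n\<close>.\<close>
  ultimately show ?thesis
    by (simp add: funpow_path_shift sum.atLeast1_atMost_eq lessThan_atLeast0)
qed

section \<open>Consistency of product kernels and of linear combinations\<close>

lemma pair_measurable:
  "1 \<le> i \<Longrightarrow> 1 \<le> j \<Longrightarrow> (\<lambda>\<omega>. (X i \<omega>, X j \<omega>)) \<in> borel_measurable M"
  by (intro borel_measurable_Pair X_measurable)

lemma ustat_measurable:
  assumes "h \<in> borel_measurable borel"
  shows "(\<lambda>\<omega>. ustat n h (\<lambda>i. X i \<omega>)) \<in> borel_measurable M"
  unfolding ustat_def split_def
  by (intro borel_measurable_times borel_measurable_const borel_measurable_sum
      measurable_compose[OF pair_measurable assms]) (auto simp: pairs_def)

text \<open>The error is measured by a nonnegative integral, so it can be estimated before any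
  integrability is known. The centring term is a Bochner integral, which is 0 by convention for a
  non-integrable kernel; integrability of the kernel is therefore tracked separately.\<close>

definition consistent :: "('a \<times> 'a \<Rightarrow> real) \<Rightarrow> bool" where
  "consistent h \<longleftrightarrow> (\<lambda>n. \<integral>\<^sup>+\<omega>. ennreal \<bar>ustat n h (\<lambda>i. X i \<omega>)
      - integral\<^sup>L (marginal \<Otimes>\<^sub>M marginal) h\<bar> \<partial>M) \<longlonglongrightarrow> 0"

lemma integrable_bounded:
  fixes h :: "'a \<times> 'a \<Rightarrow> real"
  assumes "h \<in> borel_measurable borel" "\<And>z. \<bar>h z\<bar> \<le> B"
  shows "integrable (marginal \<Otimes>\<^sub>M marginal) h"
  using assms by (intro FF.integrable_const_bound[of _ B]) auto

text \<open>Pathwise, \<open>sum_mult_pairs_tendsto\<close> applies to the averages of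
  \<open>a\<close> and \<open>b\<close>, giving almost sure convergence to the product of the means.
  Boundedness upgrades this to convergence in mean by domination.\<close>

lemma consistent_product:
  assumes a [measurable]: "a \<in> borel_measurable borel" and b [measurable]: "b \<in> borel_measurable borel"
    and a_le: "\<And>x. \<bar>a x\<bar> \<le> A" and b_le: "\<And>x. \<bar>b x\<bar> \<le> B"
  shows "consistent (\<lambda>(x, y). a x * b y)"
proof -
  let ?h = "\<lambda>(x, y). a x * b y"
  have [measurable]: "?h \<in> borel_measurable (borel :: ('a \<times> 'a) measure)"
    unfolding borel_prod[symmetric] by measurable
  have bound: "\<bar>?h z\<bar> \<le> A * B" for z
    using mult_mono[OF a_le[of "fst z"] b_le[of "snd z"]] a_le[of undefined]
    by (simp add: abs_mult split_def)
  have int: "integrable marginal a" "integrable marginal b"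
    using a_le b_le by (auto intro: F.integrable_const_bound[of _ A] F.integrable_const_bound[of _ B])
  have "integral\<^sup>L (marginal \<Otimes>\<^sub>M marginal) ?h = (\<integral>x. (\<integral>y. a x * b y \<partial>marginal) \<partial>marginal)"
    using FF.integral_fst'[of ?h, OF integrable_bounded[OF _ bound]] by simp
  then have \<theta>: "integral\<^sup>L (marginal \<Otimes>\<^sub>M marginal) ?h = integral\<^sup>L marginal a * integral\<^sup>L marginal b"
    by simp
  have "AE \<omega> in M. (\<lambda>n. ustat n ?h (\<lambda>i. X i \<omega>)) \<longlonglongrightarrow> integral\<^sup>L (marginal \<Otimes>\<^sub>M marginal) ?h"
    using AE_averages_tendsto[OF a int(1)] AE_averages_tendsto[OF b int(2)]
  proof eventually_elim
    case (elim \<omega>)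
    show ?case
      using sum_mult_pairs_tendsto[OF elim b_le] by (simp add: ustat_def \<theta>)
  qed
  then have conv: "AE \<omega> in M. (\<lambda>n. ennreal \<bar>ustat n ?h (\<lambda>i. X i \<omega>)
      - integral\<^sup>L (marginal \<Otimes>\<^sub>M marginal) ?h\<bar>) \<longlonglongrightarrow> 0"
    by eventually_elim (auto simp flip: ennreal_0 intro!: tendsto_ennrealI tendsto_rabs_zero LIM_zero)
  have "(\<lambda>n. \<integral>\<^sup>+\<omega>. ennreal \<bar>ustat n ?h (\<lambda>i. X i \<omega>)
      - integral\<^sup>L (marginal \<Otimes>\<^sub>M marginal) ?h\<bar> \<partial>M) \<longlonglongrightarrow> (\<integral>\<^sup>+\<omega>. 0 \<partial>M)"
  proof (rule nn_integral_dominated_convergence[where w = "\<lambda>_. ennreal (A * B + \<bar>integral\<^sup>L (marginal \<Otimes>\<^sub>M marginal) ?h\<bar>)"])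
    fix n
    have "\<bar>ustat n ?h (\<lambda>i. X i \<omega>)\<bar> \<le> A * B" for \<omega>
      by (rule abs_ustat_le_bound) (rule bound)
    then have "\<bar>ustat n ?h (\<lambda>i. X i \<omega>) - integral\<^sup>L (marginal \<Otimes>\<^sub>M marginal) ?h\<bar>
        \<le> A * B + \<bar>integral\<^sup>L (marginal \<Otimes>\<^sub>M marginal) ?h\<bar>" for \<omega>
      using abs_triangle_ineq4 add_mono order_refl order_trans by meson
    then show "AE \<omega> in M. ennreal \<bar>ustat n ?h (\<lambda>i. X i \<omega>) - integral\<^sup>L (marginal \<Otimes>\<^sub>M marginal) ?h\<bar>
        \<le> ennreal (A * B + \<bar>integral\<^sup>L (marginal \<Otimes>\<^sub>M marginal) ?h\<bar>)"
      by (intro AE_I2 ennreal_leI)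
  qed (use conv in \<open>auto simp: emeasure_space_1 ennreal_mult_less_top intro!: borel_measurable_abs borel_measurable_diff ustat_measurable\<close>)
  then show ?thesis
    by (simp add: consistent_def)
qed

lemma consistent_sum:
  assumes "finite K" and meas: "\<And>k. k \<in> K \<Longrightarrow> g k \<in> borel_measurable borel"
    and int: "\<And>k. k \<in> K \<Longrightarrow> integrable (marginal \<Otimes>\<^sub>M marginal) (g k)"
    and cons: "\<And>k. k \<in> K \<Longrightarrow> consistent (g k)"
  shows "consistent (\<lambda>z. \<Sum>k\<in>K. c k * g k z)"
proof -
  let ?I = "integral\<^sup>L (marginal \<Otimes>\<^sub>M marginal)"
  have \<theta>: "?I (\<lambda>z. \<Sum>k\<in>K. c k * g k z) = (\<Sum>k\<in>K. c k * ?I (g k))"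
    using int by simp
  have le: "(\<integral>\<^sup>+\<omega>. ennreal \<bar>ustat n (\<lambda>z. \<Sum>k\<in>K. c k * g k z) (\<lambda>i. X i \<omega>) - ?I (\<lambda>z. \<Sum>k\<in>K. c k * g k z)\<bar> \<partial>M)
      \<le> (\<Sum>k\<in>K. ennreal \<bar>c k\<bar> * (\<integral>\<^sup>+\<omega>. ennreal \<bar>ustat n (g k) (\<lambda>i. X i \<omega>) - ?I (g k)\<bar> \<partial>M))" for n
  proof -
    have "(\<integral>\<^sup>+\<omega>. ennreal \<bar>ustat n (\<lambda>z. \<Sum>k\<in>K. c k * g k z) (\<lambda>i. X i \<omega>) - ?I (\<lambda>z. \<Sum>k\<in>K. c k * g k z)\<bar> \<partial>M)
      \<le> (\<integral>\<^sup>+\<omega>. (\<Sum>k\<in>K. ennreal \<bar>c k\<bar> * ennreal \<bar>ustat n (g k) (\<lambda>i. X i \<omega>) - ?I (g k)\<bar>) \<partial>M)"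
    proof (rule nn_integral_mono)
      fix \<omega>
      have "\<bar>ustat n (\<lambda>z. \<Sum>k\<in>K. c k * g k z) (\<lambda>i. X i \<omega>) - ?I (\<lambda>z. \<Sum>k\<in>K. c k * g k z)\<bar>
          = \<bar>\<Sum>k\<in>K. c k * (ustat n (g k) (\<lambda>i. X i \<omega>) - ?I (g k))\<bar>"
        unfolding \<theta> ustat_sum by (simp add: sum_subtractf right_diff_distrib)
      also have "\<dots> \<le> (\<Sum>k\<in>K. \<bar>c k\<bar> * \<bar>ustat n (g k) (\<lambda>i. X i \<omega>) - ?I (g k)\<bar>)"
        using sum_abs[of "\<lambda>k. c k * (ustat n (g k) (\<lambda>i. X i \<omega>) - ?I (g k))" K] by (simp only: abs_mult)
      finally show "ennreal \<bar>ustat n (\<lambda>z. \<Sum>k\<in>K. c k * g k z) (\<lambda>i. X i \<omega>) - ?I (\<lambda>z. \<Sum>k\<in>K. c k * g k z)\<bar>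
          \<le> (\<Sum>k\<in>K. ennreal \<bar>c k\<bar> * ennreal \<bar>ustat n (g k) (\<lambda>i. X i \<omega>) - ?I (g k)\<bar>)"
        by (simp add: ennreal_leI sum_nonneg flip: ennreal_mult)
    qed
    also have "\<dots> = (\<Sum>k\<in>K. ennreal \<bar>c k\<bar> * (\<integral>\<^sup>+\<omega>. ennreal \<bar>ustat n (g k) (\<lambda>i. X i \<omega>) - ?I (g k)\<bar> \<partial>M))"
      using meas ustat_measurable
      by (subst nn_integral_sum) (auto intro!: sum.cong nn_integral_cmult)
    finally show ?thesis .
  qed
  have lim: "(\<lambda>n. \<Sum>k\<in>K. ennreal \<bar>c k\<bar> * (\<integral>\<^sup>+\<omega>. ennreal \<bar>ustat n (g k) (\<lambda>i. X i \<omega>) - ?I (g k)\<bar> \<partial>M))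
      \<longlonglongrightarrow> (\<Sum>k\<in>K. ennreal \<bar>c k\<bar> * 0)"
    using cons unfolding consistent_def by (intro tendsto_sum ennreal_tendsto_cmult) auto
  show ?thesis
    unfolding consistent_def
  proof (rule tendsto_sandwich[OF _ _ tendsto_const])
    show "(\<lambda>n. \<Sum>k\<in>K. ennreal \<bar>c k\<bar> * (\<integral>\<^sup>+\<omega>. ennreal \<bar>ustat n (g k) (\<lambda>i. X i \<omega>) - ?I (g k)\<bar> \<partial>M)) \<longlonglongrightarrow> 0"
      using lim by simp
  qed (use le in simp_all)
qed

text \<open>Every summand has the law of some pair \<open>(X 1, X (1 + k))\<close>, and the weights
  add up to at most 1. This is how bounds uniform in the gap reach all U-statistics.\<close>

lemma nn_integral_ustat_le:
  assumes d: "d \<in> borel_measurable borel"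
    and le: "\<And>k. 1 \<le> k \<Longrightarrow> (\<integral>\<^sup>+\<omega>. ennreal \<bar>d (X 1 \<omega>, X (1 + k) \<omega>)\<bar> \<partial>M) \<le> C"
  shows "(\<integral>\<^sup>+\<omega>. ennreal \<bar>ustat n d (\<lambda>i. X i \<omega>)\<bar> \<partial>M) \<le> C"
proof -
  let ?w = "ennreal (1 / real (n choose 2))"
  have d_pair: "(\<lambda>\<omega>. ennreal \<bar>d (X i \<omega>, X j \<omega>)\<bar>) \<in> borel_measurable M" if "(i, j) \<in> pairs n" for i j
    using that d by (intro measurable_compose[OF pair_measurable, of _ _ "\<lambda>z. ennreal \<bar>d z\<bar>"]) (auto simp: pairs_def)
  have "(\<integral>\<^sup>+\<omega>. ennreal \<bar>ustat n d (\<lambda>i. X i \<omega>)\<bar> \<partial>M)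
      \<le> (\<integral>\<^sup>+\<omega>. (\<Sum>p\<in>pairs n. ?w * ennreal \<bar>d (X (fst p) \<omega>, X (snd p) \<omega>)\<bar>) \<partial>M)"
  proof (rule nn_integral_mono)
    fix \<omega>
    have "ennreal \<bar>ustat n d (\<lambda>i. X i \<omega>)\<bar> \<le> ennreal (ustat n (\<lambda>z. \<bar>d z\<bar>) (\<lambda>i. X i \<omega>))"
      by (intro ennreal_leI abs_ustat_le)
    also have "\<dots> = (\<Sum>p\<in>pairs n. ?w * ennreal \<bar>d (X (fst p) \<omega>, X (snd p) \<omega>)\<bar>)"
      unfolding ustat_def split_def by (simp add: sum_distrib_left flip: ennreal_mult)
    finally show "ennreal \<bar>ustat n d (\<lambda>i. X i \<omega>)\<bar> \<le> (\<Sum>p\<in>pairs n. ?w * ennreal \<bar>d (X (fst p) \<omega>, X (snd p) \<omega>)\<bar>)" .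
  qed
  also have "\<dots> = (\<Sum>p\<in>pairs n. ?w * (\<integral>\<^sup>+\<omega>. ennreal \<bar>d (X (fst p) \<omega>, X (snd p) \<omega>)\<bar> \<partial>M))"
    using d_pair by (subst nn_integral_sum) (auto intro!: sum.cong nn_integral_cmult)
  also have "\<dots> \<le> (\<Sum>p\<in>pairs n. ?w * C)"
  proof (intro sum_mono mult_left_mono)
    fix p assume "p \<in> pairs n"
    then have p: "1 \<le> fst p" "fst p < snd p" by (auto simp: pairs_def)
    show "(\<integral>\<^sup>+\<omega>. ennreal \<bar>d (X (fst p) \<omega>, X (snd p) \<omega>)\<bar> \<partial>M) \<le> C"
      using nn_integral_pair_shift[OF _ p, of "\<lambda>z. ennreal \<bar>d z\<bar>"] le[of "snd p - fst p"] d p by simp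
  qed simp
  also have "\<dots> = ennreal (real (n choose 2)) * ?w * C"
    by (simp add: card_pairs mult.assoc ennreal_of_nat_eq_real_of_nat)
  \<comment> \<open>The product of count and weight is 1, or 0 when there are no pairs.\<close>
  also have "\<dots> \<le> 1 * C"
    by (intro mult_right_mono) (auto simp flip: ennreal_mult ennreal_1 intro!: ennreal_leI)
  finally show ?thesis by simp
qed

text \<open>Three errors of size e/3: from \<open>h\<close> to \<open>g\<close> inside the
  U-statistic, from that of \<open>g\<close> to its integral, and between the two integrals. The
  first and third are separate demands because pair laws and product measure are unrelated here.
  Asking for the first only eventually in \<open>n\<close> leaves room for bounds that themselves
  come from a limit.\<close>

lemma consistent_closure:
  assumes h: "h \<in> borel_measurable borel"
    and approx: "\<And>e::real. 0 < e \<Longrightarrow> \<exists>g\<in>borel_measurable borel. consistent g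
      \<and> (\<forall>\<^sub>F n in sequentially. (\<integral>\<^sup>+\<omega>. ennreal \<bar>ustat n (\<lambda>z. h z - g z) (\<lambda>i. X i \<omega>)\<bar> \<partial>M) \<le> ennreal e)
      \<and> \<bar>integral\<^sup>L (marginal \<Otimes>\<^sub>M marginal) h - integral\<^sup>L (marginal \<Otimes>\<^sub>M marginal) g\<bar> \<le> e"
  shows "consistent h"
  unfolding consistent_def
proof (rule tendsto_zero_ennrealI)
  let ?I = "integral\<^sup>L (marginal \<Otimes>\<^sub>M marginal)"
  fix e :: real assume "0 < e"
  then have e: "0 < e / 3" by simp
  obtain g where g: "g \<in> borel_measurable borel" and cons: "consistent g"
    and diff: "\<forall>\<^sub>F n in sequentially. (\<integral>\<^sup>+\<omega>. ennreal \<bar>ustat n (\<lambda>z. h z - g z) (\<lambda>i. X i \<omega>)\<bar> \<partial>M) \<le> ennreal (e / 3)"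
    and \<theta>: "\<bar>?I h - ?I g\<bar> \<le> e / 3"
    using approx[OF e] by blast
  have "\<forall>\<^sub>F n in sequentially. (\<integral>\<^sup>+\<omega>. ennreal \<bar>ustat n g (\<lambda>i. X i \<omega>) - ?I g\<bar> \<partial>M) \<le> ennreal (e / 3)"
    using cons e unfolding consistent_def by (rule tendsto_zero_ennrealD)
  with diff show "\<forall>\<^sub>F n in sequentially. (\<integral>\<^sup>+\<omega>. ennreal \<bar>ustat n h (\<lambda>i. X i \<omega>) - ?I h\<bar> \<partial>M) \<le> ennreal e"
  proof eventually_elim
    case (elim n)
    note [measurable] = ustat_measurable[OF h, of n] ustat_measurable[OF g, of n]
    have "(\<integral>\<^sup>+\<omega>. ennreal \<bar>ustat n h (\<lambda>i. X i \<omega>) - ?I h\<bar> \<partial>M)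
        \<le> (\<integral>\<^sup>+\<omega>. ennreal \<bar>ustat n h (\<lambda>i. X i \<omega>) - ustat n g (\<lambda>i. X i \<omega>)\<bar>
            + (ennreal \<bar>ustat n g (\<lambda>i. X i \<omega>) - ?I g\<bar> + ennreal (e / 3)) \<partial>M)"
    proof (rule nn_integral_mono)
      fix \<omega>
      have "\<bar>ustat n h (\<lambda>i. X i \<omega>) - ?I h\<bar> \<le> \<bar>ustat n h (\<lambda>i. X i \<omega>) - ustat n g (\<lambda>i. X i \<omega>)\<bar>
            + (\<bar>ustat n g (\<lambda>i. X i \<omega>) - ?I g\<bar> + e / 3)"
        using \<theta> by linarith
      then show "ennreal \<bar>ustat n h (\<lambda>i. X i \<omega>) - ?I h\<bar> \<le> ennreal \<bar>ustat n h (\<lambda>i. X i \<omega>) - ustat n g (\<lambda>i. X i \<omega>)\<bar>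
            + (ennreal \<bar>ustat n g (\<lambda>i. X i \<omega>) - ?I g\<bar> + ennreal (e / 3))"
        using e by (simp add: ennreal_leI flip: ennreal_plus)
    qed
    also have "\<dots> = (\<integral>\<^sup>+\<omega>. ennreal \<bar>ustat n (\<lambda>z. h z - g z) (\<lambda>i. X i \<omega>)\<bar> \<partial>M)
        + ((\<integral>\<^sup>+\<omega>. ennreal \<bar>ustat n g (\<lambda>i. X i \<omega>) - ?I g\<bar> \<partial>M) + ennreal (e / 3))"
      by (simp add: nn_integral_add emeasure_space_1 ustat_diff)
    also have "\<dots> \<le> ennreal (e / 3) + (ennreal (e / 3) + ennreal (e / 3))"
      using elim by (intro add_mono) auto
    also have "\<dots> = ennreal e"
      using \<open>0 < e\<close> by (simp flip: ennreal_plus)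
    finally show ?case .
  qed
qed

text \<open>The U-statistic has mean absolute value at most \<open>C\<close> for every
  \<open>n\<close>, yet for some \<open>n\<close> it lies within \<open>e\<close> of the constant
  integral in mean. This carries bounds from the pair laws to the product measure.\<close>

lemma integral_le_of_consistent:
  assumes h: "h \<in> borel_measurable borel" and cons: "consistent h"
    and le: "\<And>k. 1 \<le> k \<Longrightarrow> (\<integral>\<^sup>+\<omega>. ennreal \<bar>h (X 1 \<omega>, X (1 + k) \<omega>)\<bar> \<partial>M) \<le> ennreal C"
    and "0 \<le> C"
  shows "integral\<^sup>L (marginal \<Otimes>\<^sub>M marginal) h \<le> C"
proof (rule field_le_epsilon)
  let ?I = "integral\<^sup>L (marginal \<Otimes>\<^sub>M marginal)"
  fix e :: real assume "0 < e"
  have "\<forall>\<^sub>F n in sequentially. (\<integral>\<^sup>+\<omega>. ennreal \<bar>ustat n h (\<lambda>i. X i \<omega>) - ?I h\<bar> \<partial>M) \<le> ennreal e"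
    using cons \<open>0 < e\<close> unfolding consistent_def by (rule tendsto_zero_ennrealD)
  then obtain n where n: "(\<integral>\<^sup>+\<omega>. ennreal \<bar>ustat n h (\<lambda>i. X i \<omega>) - ?I h\<bar> \<partial>M) \<le> ennreal e"
    by (auto dest: eventually_happens)
  note [measurable] = ustat_measurable[OF h, of n]
  have "ennreal (?I h) = (\<integral>\<^sup>+\<omega>. ennreal (?I h) \<partial>M)"
    by (simp add: emeasure_space_1)
  also have "\<dots> \<le> (\<integral>\<^sup>+\<omega>. ennreal \<bar>ustat n h (\<lambda>i. X i \<omega>)\<bar> + ennreal \<bar>ustat n h (\<lambda>i. X i \<omega>) - ?I h\<bar> \<partial>M)"
    by (intro nn_integral_mono) (auto simp flip: ennreal_plus intro!: ennreal_leI)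
  also have "\<dots> = (\<integral>\<^sup>+\<omega>. ennreal \<bar>ustat n h (\<lambda>i. X i \<omega>)\<bar> \<partial>M) + (\<integral>\<^sup>+\<omega>. ennreal \<bar>ustat n h (\<lambda>i. X i \<omega>) - ?I h\<bar> \<partial>M)"
    by (rule nn_integral_add) auto
  also have "\<dots> \<le> ennreal C + ennreal e"
    by (intro add_mono n nn_integral_ustat_le h le)
  finally show "?I h \<le> C + e"
    using \<open>0 \<le> C\<close> \<open>0 < e\<close> by (simp flip: ennreal_plus add: ennreal_le_iff)
qed

lemma abs_integral_diff_le:
  assumes "integrable (marginal \<Otimes>\<^sub>M marginal) h" "integrable (marginal \<Otimes>\<^sub>M marginal) g" and "0 \<le> e"
    and le: "(\<integral>\<^sup>+z. ennreal \<bar>h z - g z\<bar> \<partial>(marginal \<Otimes>\<^sub>M marginal)) \<le> ennreal e"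
  shows "\<bar>integral\<^sup>L (marginal \<Otimes>\<^sub>M marginal) h - integral\<^sup>L (marginal \<Otimes>\<^sub>M marginal) g\<bar> \<le> e"
proof -
  have "integrable (marginal \<Otimes>\<^sub>M marginal) (\<lambda>z. \<bar>h z - g z\<bar>)"
    using assms by simp
  then have "(\<integral>z. \<bar>h z - g z\<bar> \<partial>(marginal \<Otimes>\<^sub>M marginal)) \<le> e"
    using le \<open>0 \<le> e\<close> by (subst (asm) nn_integral_eq_integral) (auto simp: ennreal_le_iff)
  moreover have "\<bar>\<integral>z. h z - g z \<partial>(marginal \<Otimes>\<^sub>M marginal)\<bar> \<le> (\<integral>z. \<bar>h z - g z\<bar> \<partial>(marginal \<Otimes>\<^sub>M marginal))"
    by (rule integral_abs_bound)
  ultimately show ?thesis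
    using assms(1,2) by simp
qed

text \<open>Closeness uniform over the gaps controls the U-statistics, and closeness under the
  product measure controls the integrals.\<close>

lemma consistent_L1_closure:
  assumes h: "h \<in> borel_measurable borel" and int: "integrable (marginal \<Otimes>\<^sub>M marginal) h"
    and approx: "\<And>e::real. 0 < e \<Longrightarrow> \<exists>g\<in>borel_measurable borel.
      integrable (marginal \<Otimes>\<^sub>M marginal) g \<and> consistent g
      \<and> (\<forall>k\<ge>1. (\<integral>\<^sup>+\<omega>. ennreal \<bar>h (X 1 \<omega>, X (1 + k) \<omega>) - g (X 1 \<omega>, X (1 + k) \<omega>)\<bar> \<partial>M) \<le> ennreal e)
      \<and> (\<integral>\<^sup>+z. ennreal \<bar>h z - g z\<bar> \<partial>(marginal \<Otimes>\<^sub>M marginal)) \<le> ennreal e"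
  shows "consistent h"
proof (rule consistent_closure[OF h])
  fix e :: real assume "0 < e"
  then obtain g where g: "g \<in> borel_measurable borel" "integrable (marginal \<Otimes>\<^sub>M marginal) g" "consistent g"
    and pair: "\<And>k. 1 \<le> k \<Longrightarrow> (\<integral>\<^sup>+\<omega>. ennreal \<bar>h (X 1 \<omega>, X (1 + k) \<omega>) - g (X 1 \<omega>, X (1 + k) \<omega>)\<bar> \<partial>M) \<le> ennreal e"
    and prod: "(\<integral>\<^sup>+z. ennreal \<bar>h z - g z\<bar> \<partial>(marginal \<Otimes>\<^sub>M marginal)) \<le> ennreal e"
    using approx by meson
  have "(\<integral>\<^sup>+\<omega>. ennreal \<bar>ustat n (\<lambda>z. h z - g z) (\<lambda>i. X i \<omega>)\<bar> \<partial>M) \<le> ennreal e" for n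
    using h g(1) pair by (intro nn_integral_ustat_le borel_measurable_diff)
  moreover have "\<bar>integral\<^sup>L (marginal \<Otimes>\<^sub>M marginal) h - integral\<^sup>L (marginal \<Otimes>\<^sub>M marginal) g\<bar> \<le> e"
    using int g(2) prod \<open>0 < e\<close> by (intro abs_integral_diff_le) auto
  ultimately show "\<exists>g\<in>borel_measurable borel. consistent g
      \<and> (\<forall>\<^sub>F n in sequentially. (\<integral>\<^sup>+\<omega>. ennreal \<bar>ustat n (\<lambda>z. h z - g z) (\<lambda>i. X i \<omega>)\<bar> \<partial>M) \<le> ennreal e)
      \<and> \<bar>integral\<^sup>L (marginal \<Otimes>\<^sub>M marginal) h - integral\<^sup>L (marginal \<Otimes>\<^sub>M marginal) g\<bar> \<le> e"
    using g by (intro bexI[of _ g]) auto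
qed

text \<open>Uniform integrability controls the truncation error only along the pairs \<open>(X 1, X j)\<close>. Its
  integral against the product measure is a supremum of integrals of bounded kernels; these are
  consistent, so the pair expectations bound them.\<close>

lemma consistent_of_truncations:
  assumes h [measurable]: "h \<in> borel_measurable borel"
    and bounded: "\<And>\<phi> :: real \<Rightarrow> real. continuous_on UNIV \<phi> \<Longrightarrow> bounded (range \<phi>) \<Longrightarrow> consistent (\<lambda>z. \<phi> (h z))"
    and ui: "uniformly_integrable M {1::nat..} (\<lambda>j \<omega>. h (X 1 \<omega>, X j \<omega>))"
  shows "consistent h" and "integrable (marginal \<Otimes>\<^sub>M marginal) h"
proof -
  define tr where "tr R t = max (-R) (min R t)" for R t :: real
  have tr_cont: "continuous_on UNIV (tr R)" for R
    unfolding tr_def by (intro continuous_intros)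
  have tr_le: "\<bar>tr R t\<bar> \<le> R" if "0 \<le> R" for R t
    using that by (auto simp: tr_def)
  \<comment> \<open>The truncation error may be unbounded, so the hypothesis \<open>bounded\<close>
    is applied to its cap at \<open>K\<close>; the cap is removed by monotone convergence.\<close>
  have dev_cont: "continuous_on UNIV (\<lambda>t. min K \<bar>t - tr R t\<bar>)" for K R
    by (intro continuous_intros tr_cont)
  have [measurable]: "tr R \<in> borel_measurable borel" for R
    by (rule borel_measurable_continuous_onI[OF tr_cont])
  have approx: "\<exists>R\<ge>0. (\<forall>k\<ge>1. (\<integral>\<^sup>+\<omega>. ennreal \<bar>h (X 1 \<omega>, X (1 + k) \<omega>) - tr R (h (X 1 \<omega>, X (1 + k) \<omega>))\<bar> \<partial>M) \<le> ennreal e)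
      \<and> (\<integral>\<^sup>+z. ennreal \<bar>h z - tr R (h z)\<bar> \<partial>(marginal \<Otimes>\<^sub>M marginal)) \<le> ennreal e"
    if e: "0 < e" for e
  proof -
    let ?tail = "\<lambda>R::real. SUP j\<in>{1..}. \<integral>\<^sup>+\<omega>. ennreal \<bar>h (X 1 \<omega>, X j \<omega>)\<bar>
        * indicator {\<omega>. R < \<bar>h (X 1 \<omega>, X j \<omega>)\<bar>} \<omega> \<partial>M"
    have "(?tail \<longlongrightarrow> 0) at_top"
      using ui unfolding uniformly_integrable_def by (rule conjunct2)
    from tendsto_zero_ennrealD[OF this e] obtain R0 where "\<And>R. R0 \<le> R \<Longrightarrow> ?tail R \<le> ennreal e"
      unfolding eventually_at_top_linorder by blast
    then obtain R where R: "0 \<le> R" and sup: "?tail R \<le> ennreal e"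
      by (meson max.cobounded1 max.cobounded2)
    have pair: "(\<integral>\<^sup>+\<omega>. ennreal \<bar>h (X 1 \<omega>, X (1 + k) \<omega>) - tr R (h (X 1 \<omega>, X (1 + k) \<omega>))\<bar> \<partial>M) \<le> ennreal e" for k
    proof -
      \<comment> \<open>Clamping to [-R, R] moves \<open>t\<close> by the positive part of |t| - R,
        which vanishes unless |t| > R.\<close>
      have "ennreal \<bar>t - tr R t\<bar> \<le> ennreal \<bar>t\<bar> * indicator {t. R < \<bar>t\<bar>} t" for t
        using R by (auto simp: tr_def indicator_def intro!: ennreal_leI)
      then have "(\<integral>\<^sup>+\<omega>. ennreal \<bar>h (X 1 \<omega>, X (1 + k) \<omega>) - tr R (h (X 1 \<omega>, X (1 + k) \<omega>))\<bar> \<partial>M)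
          \<le> (\<integral>\<^sup>+\<omega>. ennreal \<bar>h (X 1 \<omega>, X (1 + k) \<omega>)\<bar>
            * indicator {\<omega>. R < \<bar>h (X 1 \<omega>, X (1 + k) \<omega>)\<bar>} \<omega> \<partial>M)"
        by (intro nn_integral_mono) (simp only: indicator_def mem_Collect_eq)
      also have "\<dots> \<le> (SUP j\<in>{1..}. \<integral>\<^sup>+\<omega>. ennreal \<bar>h (X 1 \<omega>, X j \<omega>)\<bar>
        * indicator {\<omega>. R < \<bar>h (X 1 \<omega>, X j \<omega>)\<bar>} \<omega> \<partial>M)"
        by (rule SUP_upper2[of "1 + k"]) auto
      finally show ?thesis
        using sup by (rule order_trans)
    qed
    have prod: "(\<integral>\<^sup>+z. ennreal (min (real K) \<bar>h z - tr R (h z)\<bar>) \<partial>(marginal \<Otimes>\<^sub>M marginal)) \<le> ennreal e" for K :: nat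
    proof -
      let ?d = "\<lambda>z. min (real K) \<bar>h z - tr R (h z)\<bar>"
      have "bounded (range (\<lambda>t. min (real K) \<bar>t - tr R t\<bar>))"
        by (auto simp: bounded_iff intro!: exI[of _ "real K"])
      then have cons: "consistent ?d"
        by (rule bounded[OF dev_cont])
      have "integral\<^sup>L (marginal \<Otimes>\<^sub>M marginal) ?d \<le> e"
      proof (rule integral_le_of_consistent[OF _ cons])
        fix k :: nat
        have "(\<integral>\<^sup>+\<omega>. ennreal \<bar>?d (X 1 \<omega>, X (1 + k) \<omega>)\<bar> \<partial>M)
            \<le> (\<integral>\<^sup>+\<omega>. ennreal \<bar>h (X 1 \<omega>, X (1 + k) \<omega>) - tr R (h (X 1 \<omega>, X (1 + k) \<omega>))\<bar> \<partial>M)"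
          by (intro nn_integral_mono ennreal_leI) auto
        then show "(\<integral>\<^sup>+\<omega>. ennreal \<bar>?d (X 1 \<omega>, X (1 + k) \<omega>)\<bar> \<partial>M) \<le> ennreal e"
          using pair[of k] by (rule order_trans)
      qed (use e in auto)
      moreover have "integrable (marginal \<Otimes>\<^sub>M marginal) ?d"
        by (rule integrable_bounded[of _ "real K"]) auto
      ultimately show ?thesis
        by (subst nn_integral_eq_integral) (auto intro: ennreal_leI)
    qed
    have "(\<lambda>K. \<integral>\<^sup>+z. ennreal (min (real K) \<bar>h z - tr R (h z)\<bar>) \<partial>(marginal \<Otimes>\<^sub>M marginal))
        \<longlonglongrightarrow> (\<integral>\<^sup>+z. ennreal \<bar>h z - tr R (h z)\<bar> \<partial>(marginal \<Otimes>\<^sub>M marginal))"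
    proof (rule nn_integral_LIMSEQ)
      show "incseq (\<lambda>K z. ennreal (min (real K) \<bar>h z - tr R (h z)\<bar>))"
        by (auto simp: incseq_def le_fun_def intro!: ennreal_leI)
      fix z
      obtain N :: nat where N: "\<bar>h z - tr R (h z)\<bar> \<le> real N"
        using real_arch_simple by blast
      have "min (real K) \<bar>h z - tr R (h z)\<bar> = \<bar>h z - tr R (h z)\<bar>" if "N \<le> K" for K
        using that N by simp
      then show "(\<lambda>K. ennreal (min (real K) \<bar>h z - tr R (h z)\<bar>)) \<longlonglongrightarrow> ennreal \<bar>h z - tr R (h z)\<bar>"
        by (intro tendsto_eventually) (auto simp: eventually_sequentially intro!: exI[of _ N])
    qed auto
    then have "(\<integral>\<^sup>+z. ennreal \<bar>h z - tr R (h z)\<bar> \<partial>(marginal \<Otimes>\<^sub>M marginal)) \<le> ennreal e"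
      by (rule LIMSEQ_le_const2) (use prod in auto)
    with R pair show ?thesis
      by blast
  qed
  have tr_int: "integrable (marginal \<Otimes>\<^sub>M marginal) (\<lambda>z. tr R (h z))" if "0 \<le> R" for R
    by (rule integrable_bounded[of _ R]) (use tr_le[OF that] in auto)
  show int: "integrable (marginal \<Otimes>\<^sub>M marginal) h"
  proof -
    obtain R where "0 \<le> R" and le: "(\<integral>\<^sup>+z. ennreal \<bar>h z - tr R (h z)\<bar> \<partial>(marginal \<Otimes>\<^sub>M marginal)) \<le> ennreal 1"
      using approx[of 1] by auto
    from le_less_trans[OF le ennreal_less_top] have "integrable (marginal \<Otimes>\<^sub>M marginal) (\<lambda>z. h z - tr R (h z))"
      by (intro integrableI_bounded) auto
    from Bochner_Integration.integrable_add[OF this tr_int[OF \<open>0 \<le> R\<close>]] show ?thesis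
      by simp
  qed
  show "consistent h"
  proof (rule consistent_L1_closure[OF h int])
    fix e :: real assume "0 < e"
    from approx[OF this] obtain R where R: "0 \<le> R"
      "\<forall>k\<ge>1. (\<integral>\<^sup>+\<omega>. ennreal \<bar>h (X 1 \<omega>, X (1 + k) \<omega>) - tr R (h (X 1 \<omega>, X (1 + k) \<omega>))\<bar> \<partial>M) \<le> ennreal e"
      "(\<integral>\<^sup>+z. ennreal \<bar>h z - tr R (h z)\<bar> \<partial>(marginal \<Otimes>\<^sub>M marginal)) \<le> ennreal e"
      by blast
    have "bounded (range (tr R))"
      using tr_le[OF R(1)] by (auto simp: bounded_iff)
    then have "consistent (\<lambda>z. tr R (h z))"
      by (rule bounded[OF tr_cont])
    then show "\<exists>g\<in>borel_measurable borel.
      integrable (marginal \<Otimes>\<^sub>M marginal) g \<and> consistent g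
      \<and> (\<forall>k\<ge>1. (\<integral>\<^sup>+\<omega>. ennreal \<bar>h (X 1 \<omega>, X (1 + k) \<omega>) - g (X 1 \<omega>, X (1 + k) \<omega>)\<bar> \<partial>M) \<le> ennreal e)
      \<and> (\<integral>\<^sup>+z. ennreal \<bar>h z - g z\<bar> \<partial>(marginal \<Otimes>\<^sub>M marginal)) \<le> ennreal e"
      using R tr_int[OF R(1)] by (intro bexI[of _ "\<lambda>z. tr R (h z)"]) auto
  qed
qed

section \<open>Almost everywhere continuous kernels\<close>

text \<open>The map \<open>c\<close> labels the cells of a finite measurable partition. With
  finitely many labels, any function of the two labels is a finite combination of indicators of
  rectangles, whatever \<phi> is. In particular suprema over cells are measurable.\<close>

lemma consistent_finite_partition:
  fixes c :: "'a \<Rightarrow> 'b" and \<phi> :: "'b \<Rightarrow> 'b \<Rightarrow> real"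
  assumes "finite (range c)" and c: "\<And>s. c -` {s} \<in> sets borel"
  shows "consistent (\<lambda>z. \<phi> (c (fst z)) (c (snd z)))"
    and "(\<lambda>z. \<phi> (c (fst z)) (c (snd z))) \<in> borel_measurable borel"
proof -
  define K where "K = range c \<times> range c"
  define g :: "'b \<times> 'b \<Rightarrow> 'a \<times> 'a \<Rightarrow> real"
    where "g p = (\<lambda>(x, y). indicator (c -` {fst p}) x * indicator (c -` {snd p}) y)" for p
  have "finite K"
    using assms by (simp add: K_def)
  have eq: "(\<lambda>z. \<phi> (c (fst z)) (c (snd z))) = (\<lambda>z. \<Sum>p\<in>K. \<phi> (fst p) (snd p) * g p z)"
  proof
    fix z
    have "(\<Sum>p\<in>K. \<phi> (fst p) (snd p) * g p z)
        = (\<Sum>p\<in>K. if p = (c (fst z), c (snd z)) then \<phi> (fst p) (snd p) else 0)"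
      by (intro sum.cong) (auto simp: g_def indicator_def split_def prod_eq_iff)
    then show "\<phi> (c (fst z)) (c (snd z)) = (\<Sum>p\<in>K. \<phi> (fst p) (snd p) * g p z)"
      using \<open>finite K\<close> by (simp add: K_def)
  qed
  have ind: "indicator (c -` {s}) \<in> borel_measurable borel" for s
    using c by simp
  have g_meas: "g p \<in> borel_measurable borel" for p
  proof -
    note [measurable] = ind
    have "g p \<in> borel_measurable (borel \<Otimes>\<^sub>M borel)"
      unfolding g_def by measurable
    then show ?thesis by (simp add: borel_prod)
  qed
  have g_cons: "consistent (g p)" for p
    unfolding g_def by (rule consistent_product[OF ind ind, where A = 1 and B = 1]) auto
  have g_int: "integrable (marginal \<Otimes>\<^sub>M marginal) (g p)" for p
    by (rule integrable_bounded[OF g_meas, where B = 1]) (auto simp: g_def indicator_def split_def)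
  show "consistent (\<lambda>z. \<phi> (c (fst z)) (c (snd z)))"
    unfolding eq by (intro consistent_sum \<open>finite K\<close> g_meas g_cons g_int)
  show "(\<lambda>z. \<phi> (c (fst z)) (c (snd z))) \<in> borel_measurable borel"
    unfolding eq by (intro borel_measurable_sum borel_measurable_times borel_measurable_const g_meas)
qed

text \<open>Consistency of the width \<open>d\<close> is the point: the mean of its U-statistic is
  eventually close to its small integral, and it dominates the U-statistic of |h - g|. Smallness
  under the product measure thus reaches the U-statistics without any estimate of single pair
  laws.\<close>

lemma consistent_sandwich:
  assumes h: "h \<in> borel_measurable borel" "integrable (marginal \<Otimes>\<^sub>M marginal) h"
    and approx: "\<And>e::real. 0 < e \<Longrightarrow> \<exists>g d. g \<in> borel_measurable borel \<and> d \<in> borel_measurable borel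
      \<and> integrable (marginal \<Otimes>\<^sub>M marginal) g \<and> integrable (marginal \<Otimes>\<^sub>M marginal) d
      \<and> consistent g \<and> consistent d \<and> (\<forall>z. \<bar>h z - g z\<bar> \<le> d z)
      \<and> integral\<^sup>L (marginal \<Otimes>\<^sub>M marginal) d \<le> e"
  shows "consistent h"
proof (rule consistent_closure[OF h(1)])
  let ?I = "integral\<^sup>L (marginal \<Otimes>\<^sub>M marginal)"
  fix e :: real assume "0 < e"
  then have "0 < e / 2" by simp
  from approx[OF this] obtain g d where gd: "g \<in> borel_measurable borel" "d \<in> borel_measurable borel"
      "integrable (marginal \<Otimes>\<^sub>M marginal) g" "integrable (marginal \<Otimes>\<^sub>M marginal) d" "consistent g"
    and d_cons: "consistent d" and d: "\<And>z. \<bar>h z - g z\<bar> \<le> d z" and d_le: "?I d \<le> e / 2"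
    by blast
  have "0 \<le> ?I d"
    using order_trans[OF abs_ge_zero d] by (intro integral_nonneg_AE) simp
  have "\<forall>\<^sub>F n in sequentially. (\<integral>\<^sup>+\<omega>. ennreal \<bar>ustat n d (\<lambda>i. X i \<omega>) - ?I d\<bar> \<partial>M) \<le> ennreal (e / 2)"
    using d_cons \<open>0 < e / 2\<close> unfolding consistent_def by (rule tendsto_zero_ennrealD)
  then have "\<forall>\<^sub>F n in sequentially. (\<integral>\<^sup>+\<omega>. ennreal \<bar>ustat n (\<lambda>z. h z - g z) (\<lambda>i. X i \<omega>)\<bar> \<partial>M) \<le> ennreal e"
  proof eventually_elim
    case (elim n)
    note [measurable] = ustat_measurable[OF gd(2), of n]
    have "(\<integral>\<^sup>+\<omega>. ennreal \<bar>ustat n (\<lambda>z. h z - g z) (\<lambda>i. X i \<omega>)\<bar> \<partial>M)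
        \<le> (\<integral>\<^sup>+\<omega>. ennreal \<bar>ustat n d (\<lambda>i. X i \<omega>) - ?I d\<bar> + ennreal (?I d) \<partial>M)"
    proof (rule nn_integral_mono)
      fix \<omega>
      have "\<bar>ustat n (\<lambda>z. h z - g z) (\<lambda>i. X i \<omega>)\<bar> \<le> ustat n d (\<lambda>i. X i \<omega>)"
        by (rule order_trans[OF abs_ustat_le ustat_mono[OF d]])
      also have "\<dots> \<le> \<bar>ustat n d (\<lambda>i. X i \<omega>) - ?I d\<bar> + ?I d"
        by linarith
      finally show "ennreal \<bar>ustat n (\<lambda>z. h z - g z) (\<lambda>i. X i \<omega>)\<bar>
          \<le> ennreal \<bar>ustat n d (\<lambda>i. X i \<omega>) - ?I d\<bar> + ennreal (?I d)"
        using \<open>0 \<le> ?I d\<close> by (simp add: ennreal_leI flip: ennreal_plus)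
    qed
    also have "\<dots> = (\<integral>\<^sup>+\<omega>. ennreal \<bar>ustat n d (\<lambda>i. X i \<omega>) - ?I d\<bar> \<partial>M) + ennreal (?I d)"
      by (simp add: nn_integral_add emeasure_space_1)
    also have "\<dots> \<le> ennreal (e / 2) + ennreal (e / 2)"
      using elim d_le by (intro add_mono ennreal_leI)
    also have "\<dots> = ennreal e"
      using \<open>0 < e\<close> by (simp flip: ennreal_plus)
    finally show ?case .
  qed
  moreover have "\<bar>?I h - ?I g\<bar> \<le> e"
  proof -
    have "\<bar>?I h - ?I g\<bar> = \<bar>?I (\<lambda>z. h z - g z)\<bar>"
      using h gd by simp
    also have "\<dots> \<le> ?I (\<lambda>z. \<bar>h z - g z\<bar>)"
      by (rule integral_abs_bound)
    also have "\<dots> \<le> ?I d"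
      using h gd d by (intro integral_mono) auto
    finally show ?thesis
      using d_le \<open>0 < e\<close> by simp
  qed
  ultimately show "\<exists>g\<in>borel_measurable borel. consistent g
      \<and> (\<forall>\<^sub>F n in sequentially. (\<integral>\<^sup>+\<omega>. ennreal \<bar>ustat n (\<lambda>z. h z - g z) (\<lambda>i. X i \<omega>)\<bar> \<partial>M) \<le> ennreal e)
      \<and> \<bar>?I h - ?I g\<bar> \<le> e"
    using gd by blast
qed

lemma consistent_AE_continuous:
  assumes h: "h \<in> borel_measurable borel" and B: "\<And>z. \<bar>h z\<bar> \<le> B"
    and cont: "AE z in marginal \<Otimes>\<^sub>M marginal. isCont h z"
  shows "consistent h"
proof (rule consistent_sandwich[OF h integrable_bounded[OF h B]])
  obtain \<B> :: "'a set set" where "countable \<B>" and basis: "topological_basis \<B>"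
    using ex_countable_basis by blast
  have "\<B> \<noteq> {}"
    using topological_basisE[OF basis open_UNIV UNIV_I] by blast
  define U where "U k = from_nat_into \<B> k" for k
  have U_open: "open (U k)" for k
    using topological_basis_open[OF basis from_nat_into[OF \<open>\<B> \<noteq> {}\<close>]] by (simp add: U_def)
  have U_basis: "\<exists>k. x \<in> U k \<and> U k \<subseteq> W" if W: "open W" "x \<in> W" for x W
  proof -
    obtain V where "V \<in> \<B>" "x \<in> V" "V \<subseteq> W"
      using topological_basisE[OF basis W] by blast
    then show ?thesis
      using from_nat_into_surj[OF \<open>countable \<B>\<close>] unfolding U_def by metis
  qed
  \<comment> \<open>The label of a point records which of the first \<open>m\<close> basic open sets
    contain it; the partitions refine as \<open>m\<close> grows.\<close>
  define c where "c m x = {k \<in> {..<m}. x \<in> U k}" for m x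
  have "range (c m) \<subseteq> Pow {..<m}" for m
    by (auto simp: c_def)
  then have c_fin: "finite (range (c m))" for m
    by (rule finite_subset) simp
  have c_meas: "c m -` {s} \<in> sets borel" for m s
  proof (cases "s \<subseteq> {..<m}")
    case True
    then have "c m x = s \<longleftrightarrow> (\<forall>k\<in>{..<m}. x \<in> U k \<longleftrightarrow> k \<in> s)" for x
      unfolding c_def by blast
    then have "c m -` {s} = {x \<in> space borel. \<forall>k\<in>{..<m}. x \<in> U k \<longleftrightarrow> k \<in> s}"
      by (simp add: vimage_def)
    moreover have "{x \<in> space borel. \<forall>k\<in>{..<m}. x \<in> U k \<longleftrightarrow> k \<in> s} \<in> sets borel"
    proof -
      have [measurable]: "U k \<in> sets borel" for k
        using U_open by simp
      show ?thesis by measurable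
    qed
    ultimately show ?thesis by simp
  next
    case False
    then have "c m -` {s} = {}"
      by (auto simp: c_def)
    then show ?thesis by simp
  qed
  \<comment> \<open>The values of \<open>h\<close> on a product of cells. Below, \<open>S\<close> is
    evaluated at the labels of an actual point, so suprema and infima are taken over nonempty
    bounded sets; \<open>d m\<close> is the oscillation of \<open>h\<close> over the cell.\<close>
  define S where "S m s t = h ` (c m -` {s} \<times> c m -` {t})" for m s t
  define g where "g m = (\<lambda>z. Sup (S m (c m (fst z)) (c m (snd z))))" for m
  define l where "l m = (\<lambda>z. Inf (S m (c m (fst z)) (c m (snd z))))" for m
  define d where "d m = (\<lambda>z. Sup (S m (c m (fst z)) (c m (snd z))) - Inf (S m (c m (fst z)) (c m (snd z))))" for m
  have g_fp: "consistent (g m)" "g m \<in> borel_measurable borel" for m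
    unfolding g_def by (rule consistent_finite_partition[OF c_fin c_meas, where \<phi> = "\<lambda>s t. Sup (S m s t)"])+
  have d_fp: "consistent (d m)" "d m \<in> borel_measurable borel" for m
    unfolding d_def by (rule consistent_finite_partition[OF c_fin c_meas, where \<phi> = "\<lambda>s t. Sup (S m s t) - Inf (S m s t)"])+
  have S_mem: "h z \<in> S m (c m (fst z)) (c m (snd z))" for m z
    unfolding S_def by (rule imageI) (simp add: mem_Times_iff)
  have S_le: "x \<in> S m s t \<Longrightarrow> - B \<le> x \<and> x \<le> B" for x m s t
    using B unfolding S_def abs_le_iff by (metis imageE minus_le_iff)
  have bdd: "bdd_above (S m s t)" "bdd_below (S m s t)" for m s t
    using S_le by (meson bdd_above.I bdd_below.I)+
  have up: "h z \<le> g m z" "l m z \<le> h z" for m z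
    unfolding g_def l_def by (rule cSup_upper[OF S_mem bdd(1)], rule cInf_lower[OF S_mem bdd(2)])
  have bnd: "g m z \<le> B" "- B \<le> l m z" for m z
    unfolding g_def l_def using S_mem S_le by (blast intro: cSup_least cInf_greatest)+
  have d_eq: "d m z = g m z - l m z" for m z
    by (simp add: d_def g_def l_def)
  have g_int: "integrable (marginal \<Otimes>\<^sub>M marginal) (g m)" for m
  proof (rule integrable_bounded[OF g_fp(2)])
    show "\<bar>g m z\<bar> \<le> B" for z
      using bnd[of m z] up(1)[of z m] up(2)[of m z] B[of z] by linarith
  qed
  have d_le: "\<bar>d m z\<bar> \<le> 2 * B" for m z
    using bnd[of m z] up(1)[of z m] up(2)[of m z] B[of z] unfolding d_eq by linarith
  have d_int: "integrable (marginal \<Otimes>\<^sub>M marginal) (d m)" for m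
    using d_le by (rule integrable_bounded[OF d_fp(2)])
  have "(\<lambda>m. integral\<^sup>L (marginal \<Otimes>\<^sub>M marginal) (d m)) \<longlonglongrightarrow> (\<integral>z. 0 \<partial>(marginal \<Otimes>\<^sub>M marginal))"
  proof (rule integral_dominated_convergence[where w = "\<lambda>_. 2 * B"])
    show "AE z in marginal \<Otimes>\<^sub>M marginal. (\<lambda>m. d m z) \<longlonglongrightarrow> 0"
      using cont
    proof eventually_elim
      case (elim z)
      show ?case
      proof (rule LIMSEQ_I)
        fix r :: real assume "0 < r"
        \<comment> \<open>With radius r/3 the oscillation is at most 2r/3, which stays strictly
          below r even if supremum and infimum reach the ends of the interval.\<close>
        then have "open (ball (h z) (r / 3))" "h z \<in> ball (h z) (r / 3)"
          by auto
        then have "\<exists>A. open A \<and> z \<in> A \<and> (\<forall>w\<in>UNIV. w \<in> A \<longrightarrow> h w \<in> ball (h z) (r / 3))"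
          by (rule elim[unfolded continuous_within_topological, THEN spec, THEN mp, THEN mp])
        then obtain A where A: "open A" "z \<in> A" "\<forall>w\<in>A. h w \<in> ball (h z) (r / 3)"
          by blast
        obtain A1 A2 where A12: "open A1" "open A2" "z \<in> A1 \<times> A2" "A1 \<times> A2 \<subseteq> A"
          by (rule open_prod_elim[OF A(1,2)])
        obtain i where i: "fst z \<in> U i" "U i \<subseteq> A1"
          using U_basis[OF A12(1), of "fst z"] A12(3) by auto
        obtain j where j: "snd z \<in> U j" "U j \<subseteq> A2"
          using U_basis[OF A12(2), of "snd z"] A12(3) by auto
        show "\<exists>no. \<forall>m\<ge>no. norm (d m z - 0) < r"
        proof (intro exI allI impI)
          \<comment> \<open>Both \<open>i\<close> and \<open>j\<close> are now below
            \<open>m\<close>, so the labels record membership in \<open>U i\<close> and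
            \<open>U j\<close>, and the whole cell of \<open>z\<close> lies inside
            \<open>A\<close>.\<close>
          fix m assume m: "m \<ge> Suc (i + j)"
          have S_ball: "h z - r / 3 \<le> x \<and> x \<le> h z + r / 3" if mem: "x \<in> S m (c m (fst z)) (c m (snd z))" for x
          proof -
            obtain u v where x: "x = h (u, v)" and uv: "c m u = c m (fst z)" "c m v = c m (snd z)"
              using mem by (auto simp: S_def)
            have "i \<in> c m u" "j \<in> c m v"
              unfolding uv using i j m by (auto simp: c_def)
            then have "(u, v) \<in> A"
              using i j A12 by (auto simp: c_def)
            from A(3)[rule_format, OF this] show ?thesis
              unfolding x mem_ball dist_real_def by linarith
          qed
          have "g m z \<le> h z + r / 3" "h z - r / 3 \<le> l m z"
            unfolding g_def l_def using S_mem S_ball by (blast intro: cSup_least cInf_greatest)+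
          then show "norm (d m z - 0) < r"
            using up(1)[of z m] up(2)[of m z] \<open>0 < r\<close> unfolding d_eq by simp
        qed
      qed
    qed
    show "AE z in marginal \<Otimes>\<^sub>M marginal. norm (d m z) \<le> 2 * B" for m
      using d_le by simp
  qed (use d_fp(2) in auto)
  then have d_lim: "(\<lambda>m. integral\<^sup>L (marginal \<Otimes>\<^sub>M marginal) (d m)) \<longlonglongrightarrow> 0"
    by simp
  fix e :: real assume "0 < e"
  obtain m where "integral\<^sup>L (marginal \<Otimes>\<^sub>M marginal) (d m) < e"
    using order_tendstoD(2)[OF d_lim \<open>0 < e\<close>] by (auto dest: eventually_happens)
  moreover have "\<bar>h z - g m z\<bar> \<le> d m z" for z
    using up(1)[of z m] up(2)[of m z] unfolding d_eq by linarith
  ultimately show "\<exists>g d. g \<in> borel_measurable borel \<and> d \<in> borel_measurable borel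
      \<and> integrable (marginal \<Otimes>\<^sub>M marginal) g \<and> integrable (marginal \<Otimes>\<^sub>M marginal) d
      \<and> consistent g \<and> consistent d \<and> (\<forall>z. \<bar>h z - g z\<bar> \<le> d z)
      \<and> integral\<^sup>L (marginal \<Otimes>\<^sub>M marginal) d \<le> e"
    using g_fp d_fp g_int d_int by (intro exI[of _ "g m"] exI[of _ "d m"]) auto
qed

section \<open>Kernels under bounded pair densities\<close>

text \<open>The hypothesis \<open>small\<close> is continuity from above at the empty set, uniform
  over all pair laws. Rectangles generate the Borel sets and are stable under intersection, so
  closure under complements and disjoint unions suffices; uniformity is what the unions
  require.\<close>

lemma consistent_indicator:
  fixes E :: "('a \<times> 'a) set"
  assumes small: "\<And>A e. range A \<subseteq> sets borel \<Longrightarrow> decseq A \<Longrightarrow> (\<Inter>n. A n) = {} \<Longrightarrow> 0 < e \<Longrightarrow>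
      \<forall>\<^sub>F n in sequentially. \<forall>k\<ge>1. emeasure M {\<omega> \<in> space M. (X 1 \<omega>, X (1 + k) \<omega>) \<in> A n} \<le> ennreal e"
    and E: "E \<in> sets borel"
  shows "consistent (indicator E)"
proof -
  have int: "integrable (marginal \<Otimes>\<^sub>M marginal) (indicator A :: _ \<Rightarrow> real)" if "A \<in> sets borel" for A :: "('a \<times> 'a) set"
    by (rule integrable_bounded[where B = 1]) (use that in \<open>auto simp: indicator_def\<close>)
  have rect: "consistent (indicator (a \<times> b))" if "a \<in> sets borel" "b \<in> sets borel" for a b :: "'a set"
  proof -
    have "consistent (\<lambda>(x, y). indicator a x * indicator b y)"
      by (rule consistent_product[where A = 1 and B = 1]) (use that in auto)
    also have "(\<lambda>(x, y). indicator a x * indicator b y) = (indicator (a \<times> b) :: _ \<Rightarrow> real)"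
      by (auto simp: fun_eq_iff indicator_def)
    finally show ?thesis .
  qed
  define G :: "('a \<times> 'a) set set" where "G = {a \<times> b |a b. a \<in> sets borel \<and> b \<in> sets borel}"
  have sets_G: "sets borel = sigma_sets UNIV G"
    unfolding borel_prod[symmetric] sets_pair_measure G_def by simp
  have "Int_stable G"
    unfolding G_def by (rule Int_stable_pair_measure_generator)
  moreover have "G \<subseteq> Pow UNIV" by simp
  moreover have "E \<in> sigma_sets UNIV G"
    using E sets_G by simp
  ultimately show ?thesis
  proof (induction rule: sigma_sets_induct_disjoint)
    case (basic A)
    then show ?case
      using rect by (auto simp: G_def)
  next
    case empty
    show ?case
      using rect[of "{}" "{}"] by (simp add: indicator_def[abs_def])
  next
    case (compl A)
    then have A: "A \<in> sets borel"
      by (simp add: sets_G)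
    have "consistent (indicator (UNIV \<times> UNIV))"
      by (rule rect) auto
    \<comment> \<open>The difference of the whole space and \<open>A\<close> is phrased as a
      two-term sum indexed by booleans, to fit \<open>consistent_sum\<close>.\<close>
    then have "consistent (\<lambda>z. \<Sum>b\<in>UNIV. (if b then 1 else - 1) * indicator (if b then UNIV else A) z)"
      using A compl int by (intro consistent_sum) auto
    also have "(\<lambda>z. \<Sum>b\<in>UNIV. (if b then 1 else - 1) * indicator (if b then UNIV else A) z)
        = (indicator (UNIV - A) :: _ \<Rightarrow> real)"
      by (auto simp: fun_eq_iff UNIV_bool indicator_def)
    finally show ?case .
  next
    case (union A)
    have A: "A i \<in> sets borel" for i
      using union(2) by (auto simp: sets_G)
    have unique: "i = j" if "z \<in> A i" "z \<in> A j" for z i j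
      using disjoint_family_onD[OF union(1), of i j] that by auto
    \<comment> \<open>The tails are exactly the error of the partial unions, and disjointness makes
      them decrease to the empty set.\<close>
    define R where "R n = (\<Union>i\<in>{n..}. A i)" for n
    have R: "R n \<in> sets borel" for n
      unfolding R_def using A by (intro sets.countable_UN') auto
    have "decseq R"
      by (force simp: R_def decseq_def)
    have "(\<Inter>n. R n) = {}"
    proof (rule ccontr)
      assume "(\<Inter>n. R n) \<noteq> {}"
      then obtain z where z: "\<And>n. z \<in> R n" by blast
      obtain i where i: "z \<in> A i"
        using z[of 0] by (auto simp: R_def)
      obtain j where j: "i < j" "z \<in> A j"
        using z[of "Suc i"] by (auto simp: R_def Suc_le_eq)
      then show False
        using unique[OF i j(2)] by simp
    qed
    have diff: "indicator (\<Union>i. A i) z - (\<Sum>i<n. 1 * indicator (A i) z) = (indicator (R n) z :: real)" for n z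
    proof -
      have "(\<Sum>i<n. 1 * indicator (A i) z) = (indicator (\<Union>i<n. A i) z :: real)"
        using union(1) by (subst indicator_UN_disjoint) (auto simp: disjoint_family_on_def)
      moreover have "(\<Union>i. A i) = (\<Union>i<n. A i) \<union> R n"
        by (auto simp: R_def) (metis atLeast_iff lessThan_iff not_le)
      moreover have "(\<Union>i<n. A i) \<inter> R n = {}"
        by (auto simp: R_def dest: unique)
      ultimately show ?thesis
        by (auto simp: indicator_def)
    qed
    have "(\<Union>i. A i) \<in> sets borel"
      using A by auto
    then show ?case
    proof (intro consistent_L1_closure int borel_measurable_indicator)
      fix e :: real assume "0 < e"
      have ev1: "\<forall>\<^sub>F n in sequentially. \<forall>k\<ge>1. emeasure M {\<omega> \<in> space M. (X 1 \<omega>, X (1 + k) \<omega>) \<in> R n} \<le> ennreal e"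
        using R \<open>decseq R\<close> \<open>(\<Inter>n. R n) = {}\<close> \<open>0 < e\<close> by (intro small) auto
      have "(\<lambda>n. emeasure (marginal \<Otimes>\<^sub>M marginal) (R n)) \<longlonglongrightarrow> emeasure (marginal \<Otimes>\<^sub>M marginal) (\<Inter>n. R n)"
      proof (rule Lim_emeasure_decseq[OF _ \<open>decseq R\<close>])
        show "range R \<subseteq> sets (marginal \<Otimes>\<^sub>M marginal)"
          unfolding sets_marginal_pair using R by blast
      qed simp
      then have "\<forall>\<^sub>F n in sequentially. emeasure (marginal \<Otimes>\<^sub>M marginal) (R n) \<le> ennreal e"
        using \<open>(\<Inter>n. R n) = {}\<close> \<open>0 < e\<close> by (intro tendsto_zero_ennrealD) auto
      from eventually_happens'[OF sequentially_bot eventually_conj[OF ev1 this]] obtain n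
        where n: "\<forall>k\<ge>1. emeasure M {\<omega> \<in> space M. (X 1 \<omega>, X (1 + k) \<omega>) \<in> R n} \<le> ennreal e"
          "emeasure (marginal \<Otimes>\<^sub>M marginal) (R n) \<le> ennreal e"
        by blast
      let ?g = "\<lambda>z. \<Sum>i<n. 1 * indicator (A i) z :: real"
      have g_cons: "consistent ?g"
        by (rule consistent_sum) (use A union int in auto)
      have g: "?g \<in> borel_measurable borel" "integrable (marginal \<Otimes>\<^sub>M marginal) ?g"
        using A int by auto
      have pair: "(\<integral>\<^sup>+\<omega>. ennreal \<bar>indicator (R n) (X 1 \<omega>, X (1 + k) \<omega>)\<bar> \<partial>M) \<le> ennreal e" if "1 \<le> k" for k
      proof -
        have "{\<omega> \<in> space M. (X 1 \<omega>, X (1 + k) \<omega>) \<in> R n} \<in> sets M"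
          by (rule measurable_sets_Collect[OF pair_measurable]) (use R in auto)
        moreover have "(\<integral>\<^sup>+\<omega>. ennreal \<bar>indicator (R n) (X 1 \<omega>, X (1 + k) \<omega>)\<bar> \<partial>M)
            = (\<integral>\<^sup>+\<omega>. indicator {\<omega> \<in> space M. (X 1 \<omega>, X (1 + k) \<omega>) \<in> R n} \<omega> \<partial>M)"
          by (intro nn_integral_cong) (auto simp: indicator_def)
        ultimately show ?thesis
          using n(1) that by simp
      qed
      then have pairs: "\<forall>k\<ge>1. (\<integral>\<^sup>+\<omega>. ennreal \<bar>indicator (R n) (X 1 \<omega>, X (1 + k) \<omega>)\<bar> \<partial>M) \<le> ennreal e"
        by blast
      have "(\<integral>\<^sup>+z. ennreal \<bar>indicator (R n) z\<bar> \<partial>(marginal \<Otimes>\<^sub>M marginal))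
          = (\<integral>\<^sup>+z. indicator (R n) z \<partial>(marginal \<Otimes>\<^sub>M marginal))"
        by (intro nn_integral_cong) (auto simp: indicator_def)
      also have "\<dots> = emeasure (marginal \<Otimes>\<^sub>M marginal) (R n)"
        by (rule nn_integral_indicator) (simp only: sets_marginal_pair R)
      also note n(2)
      finally show "\<exists>g\<in>borel_measurable borel. integrable (marginal \<Otimes>\<^sub>M marginal) g \<and> consistent g
        \<and> (\<forall>k\<ge>1. (\<integral>\<^sup>+\<omega>. ennreal \<bar>indicator (\<Union>i. A i) (X 1 \<omega>, X (1 + k) \<omega>) - g (X 1 \<omega>, X (1 + k) \<omega>)\<bar> \<partial>M) \<le> ennreal e)
        \<and> (\<integral>\<^sup>+z. ennreal \<bar>indicator (\<Union>i. A i) z - g z\<bar> \<partial>(marginal \<Otimes>\<^sub>M marginal)) \<le> ennreal e"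
        using g g_cons pairs unfolding diff[of _ n, symmetric] by (intro bexI[of _ ?g] conjI)
    qed
  qed
qed

text \<open>Rounding \<open>h\<close> down to multiples of 1/N gives finitely many values, because
  \<open>h\<close> is bounded, and a uniform error of at most 1/N. A uniform error is small under
  the pair laws and the product measure alike.\<close>

lemma consistent_bounded:
  assumes ind: "\<And>E. E \<in> sets borel \<Longrightarrow> consistent (indicator E)"
    and h: "h \<in> borel_measurable borel" and B: "\<And>z. \<bar>h z\<bar> \<le> B"
  shows "consistent h"
proof (rule consistent_L1_closure[OF h integrable_bounded[OF h B]])
  fix e :: real assume "0 < e"
  obtain N :: nat where N: "0 < N" "1 / real N < e"
    using nat_approx_posE[OF \<open>0 < e\<close>] by (metis zero_less_Suc)
  define c where "c z = \<lfloor>h z * real N\<rfloor>" for z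
  define g where "g z = real_of_int (c z) / real N" for z
  have close: "\<bar>h z - g z\<bar> \<le> e" for z
  proof -
    have "\<bar>h z * real N - real_of_int (c z)\<bar> \<le> 1"
      unfolding c_def by linarith
    moreover have "h z - g z = (h z * real N - real_of_int (c z)) / real N"
      using N by (simp add: g_def field_simps)
    ultimately have "\<bar>h z - g z\<bar> \<le> 1 / real N"
      using N by (simp add: divide_right_mono)
    with N show ?thesis by simp
  qed
  have "range c \<subseteq> {\<lfloor>- B * real N\<rfloor>..\<lfloor>B * real N\<rfloor>}"
  proof clarify
    fix z
    have "- B \<le> h z" "h z \<le> B"
      using B[of z] by linarith+
    then show "c z \<in> {\<lfloor>- B * real N\<rfloor>..\<lfloor>B * real N\<rfloor>}"
      unfolding c_def atLeastAtMost_iff by (intro conjI floor_mono mult_right_mono) auto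
  qed
  then have fin: "finite (range c)"
    by (rule finite_subset) simp
  have c_sets: "c -` {k} \<in> sets borel" for k
  proof -
    have [measurable]: "c \<in> measurable borel (count_space UNIV)"
      using h unfolding c_def by measurable
    have "c -` {k} = {z \<in> space borel. c z = k}"
      by auto
    also have "\<dots> \<in> sets borel"
      by measurable
    finally show ?thesis .
  qed
  have int: "integrable (marginal \<Otimes>\<^sub>M marginal) (indicator (c -` {k}) :: _ \<Rightarrow> real)" for k
    by (rule integrable_bounded[where B = 1]) (use c_sets in \<open>auto simp: indicator_def\<close>)
  have g_eq: "g = (\<lambda>z. \<Sum>k\<in>range c. (real_of_int k / real N) * indicator (c -` {k}) z)"
  proof
    fix z
    have "(\<Sum>k\<in>range c. (real_of_int k / real N) * indicator (c -` {k}) z)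
        = (\<Sum>k\<in>range c. if k = c z then real_of_int k / real N else 0)"
      by (intro sum.cong) (auto simp: indicator_def)
    then show "g z = (\<Sum>k\<in>range c. (real_of_int k / real N) * indicator (c -` {k}) z)"
      using fin by (simp add: g_def)
  qed
  have "consistent g"
    unfolding g_eq using c_sets int ind by (intro consistent_sum fin) auto
  moreover have "g \<in> borel_measurable borel"
    unfolding g_eq using c_sets by auto
  moreover have "integrable (marginal \<Otimes>\<^sub>M marginal) g"
    unfolding g_eq using int by auto
  moreover have "(\<integral>\<^sup>+\<omega>. ennreal \<bar>h (X 1 \<omega>, X (1 + k) \<omega>) - g (X 1 \<omega>, X (1 + k) \<omega>)\<bar> \<partial>M) \<le> ennreal e" for k
  proof -
    have "(\<integral>\<^sup>+\<omega>. ennreal \<bar>h (X 1 \<omega>, X (1 + k) \<omega>) - g (X 1 \<omega>, X (1 + k) \<omega>)\<bar> \<partial>M) \<le> (\<integral>\<^sup>+\<omega>. ennreal e \<partial>M)"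
      by (intro nn_integral_mono ennreal_leI close)
    then show ?thesis by (simp add: emeasure_space_1)
  qed
  moreover have "(\<integral>\<^sup>+z. ennreal \<bar>h z - g z\<bar> \<partial>(marginal \<Otimes>\<^sub>M marginal)) \<le> ennreal e"
  proof -
    have "(\<integral>\<^sup>+z. ennreal \<bar>h z - g z\<bar> \<partial>(marginal \<Otimes>\<^sub>M marginal)) \<le> (\<integral>\<^sup>+z. ennreal e \<partial>(marginal \<Otimes>\<^sub>M marginal))"
      by (intro nn_integral_mono ennreal_leI close)
    then show ?thesis by (simp add: FF.emeasure_space_1)
  qed
  ultimately show "\<exists>g\<in>borel_measurable borel. integrable (marginal \<Otimes>\<^sub>M marginal) g \<and> consistent g
      \<and> (\<forall>k\<ge>1. (\<integral>\<^sup>+\<omega>. ennreal \<bar>h (X 1 \<omega>, X (1 + k) \<omega>) - g (X 1 \<omega>, X (1 + k) \<omega>)\<bar> \<partial>M) \<le> ennreal e)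
      \<and> (\<integral>\<^sup>+z. ennreal \<bar>h z - g z\<bar> \<partial>(marginal \<Otimes>\<^sub>M marginal)) \<le> ennreal e"
    by blast
qed

text \<open>The one-dimensional case of stationarity, read off from the pairs
  \<open>(X i, X (Suc i))\<close> with the kernel that ignores the second entry.\<close>

lemma emeasure_X:
  assumes i: "1 \<le> i" and A: "A \<in> sets borel"
  shows "emeasure M {\<omega> \<in> space M. X i \<omega> \<in> A} = emeasure marginal A"
proof -
  note [measurable] = A
  have "(indicator (A \<times> UNIV) :: 'a \<times> 'a \<Rightarrow> ennreal) \<in> borel_measurable borel"
    unfolding borel_prod[symmetric] by measurable
  from nn_integral_pair_shift[OF this i, of "Suc i"]
  have "(\<integral>\<^sup>+\<omega>. indicator A (X i \<omega>) \<partial>M) = (\<integral>\<^sup>+\<omega>. indicator A (X 1 \<omega>) \<partial>M)"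
    by (simp add: indicator_times)
  moreover have "(\<integral>\<^sup>+\<omega>. indicator A (X j \<omega>) \<partial>M) = emeasure M {\<omega> \<in> space M. X j \<omega> \<in> A}" if "1 \<le> j" for j
  proof -
    have [measurable]: "X j \<in> borel_measurable M"
      using that by (rule X_measurable)
    have "(\<integral>\<^sup>+\<omega>. indicator A (X j \<omega>) \<partial>M) = (\<integral>\<^sup>+\<omega>. indicator {\<omega> \<in> space M. X j \<omega> \<in> A} \<omega> \<partial>M)"
      by (intro nn_integral_cong) (auto simp: indicator_def)
    also have "\<dots> = emeasure M {\<omega> \<in> space M. X j \<omega> \<in> A}"
      by (rule nn_integral_indicator) measurable
    finally show ?thesis .
  qed
  moreover have "emeasure marginal A = emeasure M {\<omega> \<in> space M. X 1 \<omega> \<in> A}"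
    unfolding marginal_def by (subst emeasure_distr) (auto intro: arg_cong[where f = "emeasure M"])
  ultimately show ?thesis
    using i by simp
qed

end

text \<open>Lebesgue measure is infinite, so sets decreasing to the empty set need not become small
  for it. A ball \<open>K\<close> outside of which the common marginal has mass at most e/3 fixes
  this: leaving \<open>K\<close> costs e/3 per coordinate, and inside \<open>K \<times> K\<close>
  the bound \<open>C\<close> reduces the matter to finite Lebesgue measure. Neither \<open>K\<close>
  nor \<open>C\<close> depends on the gap.\<close>

lemma pair_law_small_of_density:
  fixes M :: "'w measure" and Y :: "nat \<Rightarrow> 'w \<Rightarrow> 'c::euclidean_space"
  assumes "stationary_ergodic_process M Y"
    and f: "\<And>k. 1 \<le> k \<Longrightarrow> distributed M (lborel \<Otimes>\<^sub>M lborel) (\<lambda>\<omega>. (Y 1 \<omega>, Y (1 + k) \<omega>)) (f k)"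
    and C: "\<And>k z. 1 \<le> k \<Longrightarrow> f k z \<le> ennreal C"
    and A: "range A \<subseteq> sets borel" "decseq A" "(\<Inter>n. A n) = {}" and "0 < e"
  shows "\<forall>\<^sub>F n in sequentially. \<forall>k\<ge>1. emeasure M {\<omega> \<in> space M. (Y 1 \<omega>, Y (1 + k) \<omega>) \<in> A n} \<le> ennreal e"
proof -
  interpret Y: stationary_ergodic_process M Y
    by fact
  have e: "0 < e / 3"
    using \<open>0 < e\<close> by simp
  have "(\<lambda>r. emeasure Y.marginal (- cball 0 (real r))) \<longlonglongrightarrow> emeasure Y.marginal (\<Inter>r. - cball 0 (real r))"
    by (intro Lim_emeasure_decseq) (auto simp: decseq_def)
  moreover have "(\<Inter>r. - cball (0::'c) (real r)) = {}"
    by (auto simp: not_le) (meson not_le real_arch_simple)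
  ultimately have "\<forall>\<^sub>F r in sequentially. emeasure Y.marginal (- cball 0 (real r)) \<le> ennreal (e / 3)"
    using e by (intro tendsto_zero_ennrealD) auto
  then obtain r where r: "emeasure Y.marginal (- cball 0 (real r)) \<le> ennreal (e / 3)"
    by (auto dest: eventually_happens)
  define K :: "'c set" where "K = cball 0 (real r)"
  have K[measurable]: "K \<in> sets borel"
    by (simp add: K_def)
  have A_sets [measurable]: "A n \<in> sets borel" for n
    using A(1) by auto
  have KK [measurable]: "K \<times> K \<in> sets borel"
    unfolding K_def by (intro borel_closed closed_Times) auto
  have out: "emeasure M {\<omega> \<in> space M. Y i \<omega> \<notin> K} \<le> ennreal (e / 3)" if "1 \<le> i" for i
    using Y.emeasure_X[OF that, of "- K"] r by (simp add: K_def)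
  have "emeasure lborel (K \<times> K) < \<infinity>"
    unfolding K_def by (intro emeasure_bounded_finite bounded_Times) auto
  then have "emeasure lborel (A n \<inter> K \<times> K) < \<infinity>" for n
    by (rule le_less_trans[OF emeasure_mono, rotated 2]) auto
  then have "(\<lambda>n. emeasure lborel (A n \<inter> K \<times> K)) \<longlonglongrightarrow> emeasure lborel (\<Inter>n. A n \<inter> K \<times> K)"
    using A(2) by (intro Lim_emeasure_decseq) (auto simp: decseq_def less_top)
  moreover have "(\<Inter>n. A n \<inter> K \<times> K) = {}"
    using A(3) by auto
  ultimately have "(\<lambda>n. ennreal C * emeasure lborel (A n \<inter> K \<times> K)) \<longlonglongrightarrow> ennreal C * 0"
    by (intro ennreal_tendsto_cmult) auto
  then have "\<forall>\<^sub>F n in sequentially. ennreal C * emeasure lborel (A n \<inter> K \<times> K) \<le> ennreal (e / 3)"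
    using e by (intro tendsto_zero_ennrealD) auto
  then show ?thesis
  proof eventually_elim
    case (elim n)
    show ?case
    proof (intro allI impI)
      fix k :: nat assume k: "1 \<le> k"
      have [measurable]: "Y 1 \<in> borel_measurable M" "Y (1 + k) \<in> borel_measurable M"
        using k by (auto intro: Y.X_measurable)
      have [measurable]: "(\<lambda>\<omega>. (Y 1 \<omega>, Y (1 + k) \<omega>)) \<in> borel_measurable M"
        by (rule Y.pair_measurable) auto
      let ?Z = "\<lambda>\<omega>. (Y 1 \<omega>, Y (1 + k) \<omega>)"
      have "{\<omega> \<in> space M. ?Z \<omega> \<in> A n} \<subseteq> {\<omega> \<in> space M. ?Z \<omega> \<in> A n \<inter> K \<times> K}
          \<union> ({\<omega> \<in> space M. Y 1 \<omega> \<notin> K} \<union> {\<omega> \<in> space M. Y (1 + k) \<omega> \<notin> K})"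
        by auto
      then have "emeasure M {\<omega> \<in> space M. ?Z \<omega> \<in> A n} \<le> emeasure M ({\<omega> \<in> space M. ?Z \<omega> \<in> A n \<inter> K \<times> K}
          \<union> ({\<omega> \<in> space M. Y 1 \<omega> \<notin> K} \<union> {\<omega> \<in> space M. Y (1 + k) \<omega> \<notin> K}))"
        by (rule emeasure_mono) measurable
      also have "\<dots> \<le> emeasure M {\<omega> \<in> space M. ?Z \<omega> \<in> A n \<inter> K \<times> K}
          + (emeasure M {\<omega> \<in> space M. Y 1 \<omega> \<notin> K} + emeasure M {\<omega> \<in> space M. Y (1 + k) \<omega> \<notin> K})"
        by (intro order_trans[OF emeasure_subadditive] add_left_mono emeasure_subadditive) measurable
      also have "\<dots> \<le> ennreal (e / 3) + (ennreal (e / 3) + ennreal (e / 3))"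
      proof (intro add_mono out)
        have AK: "A n \<inter> K \<times> K \<in> sets (lborel \<Otimes>\<^sub>M lborel)"
          unfolding lborel_prod by simp
        have "emeasure M {\<omega> \<in> space M. ?Z \<omega> \<in> A n \<inter> K \<times> K} = emeasure M (?Z -` (A n \<inter> K \<times> K) \<inter> space M)"
          by (rule arg_cong[where f = "emeasure M"]) auto
        also have "\<dots> = (\<integral>\<^sup>+z. f k z * indicator (A n \<inter> K \<times> K) z \<partial>(lborel \<Otimes>\<^sub>M lborel))"
          by (rule distributed_emeasure[OF f[OF k] AK])
        also have "\<dots> \<le> (\<integral>\<^sup>+z. ennreal C * indicator (A n \<inter> K \<times> K) z \<partial>(lborel \<Otimes>\<^sub>M lborel))"
          by (intro nn_integral_mono mult_right_mono C k) simp
        also have "\<dots> = ennreal C * emeasure lborel (A n \<inter> K \<times> K)"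
          using AK by (simp add: nn_integral_cmult_indicator lborel_prod)
        also note elim
        finally show "emeasure M {\<omega> \<in> space M. ?Z \<omega> \<in> A n \<inter> K \<times> K} \<le> ennreal (e / 3)" .
      qed auto
      also have "\<dots> = ennreal e"
        using \<open>0 < e\<close> by (simp flip: ennreal_plus)
      finally show "emeasure M {\<omega> \<in> space M. ?Z \<omega> \<in> A n} \<le> ennreal e" .
    qed
  qed
qed

theorem theorem3p1:
  fixes M :: "'w measure"
    and X :: "nat \<Rightarrow> 'w \<Rightarrow> real ^ 'd"
    and h :: "(real ^ 'd) \<times> (real ^ 'd) \<Rightarrow> real"
    and F :: "(real ^ 'd) measure"
  assumes "prob_space M"
    and "\<And>i. i \<ge> 1 \<Longrightarrow> X i \<in> borel_measurable M"
    and "stationary_ergodic M X"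
    and "h \<in> borel_measurable borel"
    and "uniformly_integrable M {1::nat..} (\<lambda>j \<omega>. h (X 1 \<omega>, X j \<omega>))"
    and "F = distr M borel (X 1)"
    and "((AE z in F \<Otimes>\<^sub>M F. isCont h z) \<and> (\<forall>x y. h (x, y) = h (y, x)))
       \<or> ((\<integral>\<^sup>+y. (\<integral>\<^sup>+x. ennreal \<bar>h (x, y)\<bar> \<partial>F) \<partial>F) < \<infinity>
          \<and> (\<exists>g. distributed M lborel (X 1) g \<and> (SUP x. g x) < \<infinity>)
          \<and> (\<exists>f :: nat \<Rightarrow> (real ^ 'd) \<times> (real ^ 'd) \<Rightarrow> ennreal.
                (\<forall>k\<ge>1. distributed M (lborel \<Otimes>\<^sub>M lborel) (\<lambda>\<omega>. (X 1 \<omega>, X (1 + k) \<omega>)) (f k))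
              \<and> (SUP k\<in>{1..}. SUP (s, t). f k (s, t)) < \<infinity>))"
  shows "(\<lambda>n::nat. \<integral>\<^sup>+\<omega>. ennreal
            \<bar>1 / real (n choose 2) * (\<Sum>(i, j)\<in>{(i, j). 1 \<le> i \<and> i < j \<and> j \<le> n}. h (X i \<omega>, X j \<omega>))
              - (\<integral>y. (\<integral>x. h (x, y) \<partial>F) \<partial>F)\<bar> \<partial>M) \<longlonglongrightarrow> 0"
proof -
  interpret prob_space M by fact
  interpret stationary_ergodic_process M X
    using assms(2,3) by unfold_locales auto
  have F: "F = marginal"
    using assms(6) by (simp add: marginal_def)
  \<comment> \<open>Composites with bounded continuous functions cover both the truncations of
    \<open>h\<close> and the capped truncation errors that \<open>consistent_of_truncations\<close>
    examines.\<close>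
  have bounded: "consistent (\<lambda>z. \<phi> (h z))"
    if \<phi>: "continuous_on UNIV \<phi>" and "bounded (range \<phi>)" for \<phi> :: "real \<Rightarrow> real"
  proof -
    obtain B where B: "\<And>t. \<bar>\<phi> t\<bar> \<le> B"
      using \<open>bounded (range \<phi>)\<close> by (auto simp: bounded_iff)
    have [measurable]: "\<phi> \<in> borel_measurable borel" "h \<in> borel_measurable borel"
      using \<phi> assms(4) by (auto intro: borel_measurable_continuous_onI)
    have \<phi>h: "(\<lambda>z. \<phi> (h z)) \<in> borel_measurable borel"
      by measurable
    consider "AE z in marginal \<Otimes>\<^sub>M marginal. isCont h z"
      | f :: "nat \<Rightarrow> (real ^ 'd) \<times> (real ^ 'd) \<Rightarrow> ennreal" where
        "\<forall>k\<ge>1. distributed M (lborel \<Otimes>\<^sub>M lborel) (\<lambda>\<omega>. (X 1 \<omega>, X (1 + k) \<omega>)) (f k)"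
        "(SUP k\<in>{1..}. SUP (s, t). f k (s, t)) < \<infinity>"
      using assms(7) unfolding F by blast
    then show ?thesis
    proof cases
      case 1
      \<comment> \<open>Since \<phi> is continuous everywhere, the composite is continuous wherever
        \<open>h\<close> is.\<close>
      then have "AE z in marginal \<Otimes>\<^sub>M marginal. isCont (\<lambda>z. \<phi> (h z)) z"
      proof eventually_elim
        case (elim z)
        then show ?case
          by (rule isCont_o2) (use \<phi> in \<open>auto simp: continuous_on_eq_continuous_at\<close>)
      qed
      with \<phi>h B show ?thesis
        by (rule consistent_AE_continuous)
    next
      case (2 f)
      note f = 2(1) and sup = 2(2)
      obtain C where C: "(SUP k\<in>{1..}. SUP (s, t). f k (s, t)) = ennreal C"
        using sup unfolding infinity_ennreal_def less_top_ennreal by blast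
      have f_le: "f k z \<le> ennreal C" if "1 \<le> k" for k z
      proof -
        have "f k z \<le> (SUP (s, t). f k (s, t))"
          using SUP_upper[of z UNIV "f k"] by simp
        also have "\<dots> \<le> (SUP k\<in>{1..}. SUP (s, t). f k (s, t))"
          by (rule SUP_upper) (use that in simp)
        finally show ?thesis
          unfolding C .
      qed
      have "consistent (indicator E)" if "E \<in> sets borel" for E
      proof (rule consistent_indicator[OF _ that])
        fix A :: "nat \<Rightarrow> ((real ^ 'd) \<times> (real ^ 'd)) set" and e :: real
        assume "range A \<subseteq> sets borel" "decseq A" "(\<Inter>n. A n) = {}" "0 < e"
        then show "\<forall>\<^sub>F n in sequentially. \<forall>k\<ge>1. emeasure M {\<omega> \<in> space M. (X 1 \<omega>, X (1 + k) \<omega>) \<in> A n} \<le> ennreal e"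
          using f f_le
          by (intro pair_law_small_of_density[of M X f C] stationary_ergodic_process_axioms) auto
      qed
      then show ?thesis
        using \<phi>h B by (rule consistent_bounded)
    qed
  qed
  have cons: "consistent h" and int: "integrable (marginal \<Otimes>\<^sub>M marginal) h"
    using consistent_of_truncations[OF assms(4) bounded assms(5)] by blast+
  \<comment> \<open>Fubini's theorem with the first variable innermost, justified by the
    integrability just obtained from uniform integrability.\<close>
  have "(\<integral>y. (\<integral>x. h (x, y) \<partial>marginal) \<partial>marginal) = integral\<^sup>L (marginal \<Otimes>\<^sub>M marginal) h"
    using FF.integral_snd[of "\<lambda>x y. h (x, y)"] int by simp
  then show ?thesis
    using cons by (simp add: consistent_def ustat_def pairs_def F)
qed

end
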